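(* Let $G=(V,E)$ be a (connected) Eulerian digraph, and let $v_0$ be a fixed vertex of $G$. Let $\lambda_{G,v_0}$ be the greedoid polynomial of the directed branching greedoid of $G$ with root $v_0$. Let $A$ be any totally unimodular matrix representing the oriented dual of the graphic matroid of $G$, and let $\mathcal{Q}_A$ be the root polytope of $A$. Then $$\lambda_{G,v_0}(t)=t^{|V|-1}\,h^*_{\mathcal{Q}_A}\left(t^{-1}\right).$$
   Context: Digraphs are finite and may have multiple edges; Eulerian digraphs are connected, and Eulerian means in-degree equals out-degree at every vertex. **Greedoid polynomial.** A tree in $G$ is a subgraph whose underlying undirected graph is connected and cycle-free. An arborescence rooted at $v_0$ is a tree $F$ containing $v_0$ in which every edge $e$ is oriented away from $v_0$ (its tail lies in the component of $F-e$ containing $v_0$). It is spanning if it contains all vertices. The directed branching greedoid of $G$ with root $v_0$ has ground set $E$, its accessible sets are the (edge sets of) arborescences rooted at $v_0$, and its bases are the spanning arborescences rooted at $v_0$. Its dual complex is the abstract simplicial complex $\mathcal{S}$ of all $S\subseteq E$ such that $E\setminus S$ contains a basis; $\dim S=|S|-1$ (so $\dim\emptyset=-1$). For a simplicial complex $\mathcal S$ of dimension $d$, the $h$-polynomial is $h(x)=f(x-1)$ where $f(y)=\sum_{S\in\mathcal{S}}y^{d-\dim S}$. The greedoid polynomial $\lambda_{G,v_0}$ is the $h$-polynomial of the dual complex. **Representation of the oriented dual.** A matrix is totally unimodular if all its subdeterminants are in $\{0,1,-1\}$. For a totally unimodular matrix $A$ with columns $(a_i)_{i\in E}$ in $\mathbb{Z}^n$,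 a circuit is a minimal $C\subseteq E$ with $\{a_i\}_{i\in C}$ linearly dependent (as a family). A signed circuit is a pair $(C^+,C^-)$ with $C=C^+\sqcup C^-$ a circuit for which there is a linear dependence $\sum_{i\in C}\lambda_i a_i=0$ with $\lambda_i>0$ on $C^+$ and $\lambda_i<0$ on $C^-$ (so both $(C^+,C^-)$ and $(C^-,C^+)$ are signed circuits). A cut of $G$ is the set of all edges joining $V_1$ and $V_2$ for a partition $V=V_1\sqcup V_2$; an elementary cut is an inclusion-minimal nonempty cut; its signing consists of the set of its edges directed from $V_1$ to $V_2$ and the set of its edges directed from $V_2$ to $V_1$ (in either order). $A$ represents the oriented dual of the graphic matroid of $G$ if its columns are indexed by $E$ and its signed circuits are exactly the signed elementary cuts of $G$. **Root polytope and $h^*$.** $\mathcal{Q}_A=\mathrm{Conv}\{a_i : i\in E\}$. For a $d$-dimensional lattice polytope $P\subset\mathbb{R}^n$, the Ehrhart polynomial is $\varepsilon_P(t)=|tP\cap\mathbb{Z}^n|$ for $t\in\mathbb{N}$. Writing $\varepsilon_P(t)=\sum_{k=0}^d c_k\binom{t+d-k}{d}$, the $h^*$-polynomial is $h^*_P(x)=\sum_{k=0}^d c_k x^k$.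
   Formalization: The exponent |V|-1 is corrected to |E|-|V|+1: as printed the identity fails, e.g. for two vertices joined by two edges in each direction, where λ = t^3+t^2 and h* = 1+t. *)

theory Defs
  imports
    "HOL-Analysis.Analysis"
    "HOL-Computational_Algebra.Polynomial"
    "Graph_Theory.Digraph_Component"
    "Jordan_Normal_Form.Determinant"
begin

no_notation Matrix.vec_index (infixl "$" 100)

section \<open>Eulerian digraphs\<close>

text \<open>Multiple arcs are distinct elements of \<open>arcs G\<close>; loops are not excluded.\<close>

locale eulerian_digraph = fin_digraph G for G :: "('v, 'e) pre_digraph" (structure) +
  assumes connected: "Digraph_Component.connected G"
    and balanced: "v \<in> verts G \<Longrightarrow> in_degree G v = out_degree G v"

section \<open>The directed branching greedoid\<close>

text \<open>
  The predicates forest and tree of Digraph_Component only forbid directed cycles, and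
  mk_symmetric identifies parallel and antiparallel arcs.  For cycles of the underlying undirected
  multigraph we give each arc two orientations and look at cycles that use no arc twice, so that
  a loop and a pair of parallel or antiparallel arcs are cycles, but going back and forth along
  one arc is not.
\<close>

definition bidirect :: "('v, 'e) pre_digraph \<Rightarrow> ('v, 'e \<times> bool) pre_digraph" where
  "bidirect G = \<lparr> verts = verts G, arcs = arcs G \<times> UNIV,
     tail = (\<lambda>(e, fwd). if fwd then tail G e else head G e),
     head = (\<lambda>(e, fwd). if fwd then head G e else tail G e) \<rparr>"

definition undirected_cycle :: "('v, 'e) pre_digraph \<Rightarrow> ('e \<times> bool) list \<Rightarrow> bool" where
  "undirected_cycle G p \<longleftrightarrow> pre_digraph.cycle (bidirect G) p \<and> distinct (map fst p)"

definition undirected_tree :: "('v, 'e) pre_digraph \<Rightarrow> bool" where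
  "undirected_tree F \<longleftrightarrow> Digraph_Component.connected F \<and> (\<nexists>p. undirected_cycle F p)"

definition same_component :: "('v, 'e) pre_digraph \<Rightarrow> 'v \<Rightarrow> 'v \<Rightarrow> bool" where
  "same_component G u v \<longleftrightarrow> reachable (with_proj (mk_symmetric G)) u v"

definition arborescence ::
    "('v, 'e) pre_digraph \<Rightarrow> 'v \<Rightarrow> ('v, 'e) pre_digraph \<Rightarrow> bool" where
  "arborescence G v0 F \<longleftrightarrow> subgraph F G \<and> undirected_tree F \<and> v0 \<in> verts F
     \<and> (\<forall>e\<in>arcs F. same_component (pre_digraph.del_arc F e) v0 (tail F e))"

definition branching_greedoid_bases :: "('v, 'e) pre_digraph \<Rightarrow> 'v \<Rightarrow> 'e set set" where
  "branching_greedoid_bases G v0 = {arcs F | F. arborescence G v0 F \<and> spanning F G}"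

section \<open>The greedoid polynomial\<close>

definition dual_complex :: "'e set \<Rightarrow> 'e set set \<Rightarrow> 'e set set" where
  "dual_complex E Bs = {S. S \<subseteq> E \<and> (\<exists>B\<in>Bs. B \<subseteq> E - S)}"

definition simplex_dim :: "'e set \<Rightarrow> int" where
  "simplex_dim S = int (card S) - 1"

definition complex_dim :: "'e set set \<Rightarrow> int" where
  "complex_dim K = Max (simplex_dim ` K)"

definition f_polynomial :: "'e set set \<Rightarrow> real poly" where
  "f_polynomial K = (\<Sum>S\<in>K. monom 1 (nat (complex_dim K - simplex_dim S)))"

definition h_polynomial :: "'e set set \<Rightarrow> real poly" where
  "h_polynomial K = pcompose (f_polynomial K) [:-1, 1:]"

text \<open>
  For a connected Eulerian \<open>G\<close> the bases have \<open>|V| - 1\<close> elements, so the dual complex has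
  dimension \<open>|E| - |V|\<close> and its h-polynomial is monic of degree \<open>|E| - |V| + 1\<close>.  As the constant
  term of an h*-polynomial is 1, the power of \<open>t\<close> relating the two polynomials can only be
  \<open>|E| - |V| + 1\<close>; an exponent of \<open>|V| - 1\<close> fails, for instance, for two vertices joined by two
  arcs in each direction, where the h-polynomial is \<open>t ^ 3 + t ^ 2\<close> and the h*-polynomial \<open>1 + t\<close>.
\<close>

definition greedoid_polynomial :: "('v, 'e) pre_digraph \<Rightarrow> 'v \<Rightarrow> real poly" where
  "greedoid_polynomial G v0 =
     h_polynomial (dual_complex (arcs G) (branching_greedoid_bases G v0))"

section \<open>Totally unimodular matrices and the oriented dual\<close>

text \<open>
  A matrix with columns indexed by \<open>E\<close> is a family of columns \<open>a e\<close>, \<open>e \<in> E\<close>; the values of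
  \<open>a\<close> outside \<open>E\<close> are irrelevant.
\<close>

definition totally_unimodular :: "'e set \<Rightarrow> ('e \<Rightarrow> int ^ 'n) \<Rightarrow> bool" where
  "totally_unimodular E a \<longleftrightarrow>
     (\<forall>k (r :: nat \<Rightarrow> 'n) (c :: nat \<Rightarrow> 'e).
        inj_on r {..<k} \<and> inj_on c {..<k} \<and> c ` {..<k} \<subseteq> E \<longrightarrow>
        Determinant.det (Matrix.mat k k (\<lambda>(i, j). a (c j) $ r i)) \<in> {0, 1, -1})"

definition real_col :: "('e \<Rightarrow> int ^ 'n) \<Rightarrow> 'e \<Rightarrow> real ^ 'n" where
  "real_col a e = (\<chi> i. real_of_int (a e $ i))"

definition lin_dependent_family :: "('e \<Rightarrow> int ^ 'n) \<Rightarrow> 'e set \<Rightarrow> bool" where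
  "lin_dependent_family a C \<longleftrightarrow>
     (\<exists>l :: 'e \<Rightarrow> real. (\<exists>e\<in>C. l e \<noteq> 0) \<and> (\<Sum>e\<in>C. l e *\<^sub>R real_col a e) = 0)"

definition is_circuit :: "'e set \<Rightarrow> ('e \<Rightarrow> int ^ 'n) \<Rightarrow> 'e set \<Rightarrow> bool" where
  "is_circuit E a C \<longleftrightarrow> C \<subseteq> E \<and> lin_dependent_family a C
     \<and> (\<forall>D. D \<subset> C \<longrightarrow> \<not> lin_dependent_family a D)"

definition signed_circuits :: "'e set \<Rightarrow> ('e \<Rightarrow> int ^ 'n) \<Rightarrow> ('e set \<times> 'e set) set" where
  "signed_circuits E a = {(P, N). P \<inter> N = {} \<and> is_circuit E a (P \<union> N)
     \<and> (\<exists>l :: 'e \<Rightarrow> real. (\<forall>e\<in>P. l e > 0) \<and> (\<forall>e\<in>N. l e < 0)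
          \<and> (\<Sum>e\<in>P \<union> N. l e *\<^sub>R real_col a e) = 0)}"

definition arcs_from_to :: "('v, 'e) pre_digraph \<Rightarrow> 'v set \<Rightarrow> 'v set \<Rightarrow> 'e set" where
  "arcs_from_to G X Y = {e \<in> arcs G. tail G e \<in> X \<and> head G e \<in> Y}"

definition cut :: "('v, 'e) pre_digraph \<Rightarrow> 'v set \<Rightarrow> 'e set" where
  "cut G X = arcs_from_to G X (verts G - X) \<union> arcs_from_to G (verts G - X) X"

definition elementary_cut :: "('v, 'e) pre_digraph \<Rightarrow> 'e set \<Rightarrow> bool" where
  "elementary_cut G C \<longleftrightarrow> C \<noteq> {} \<and> (\<exists>X\<subseteq>verts G. C = cut G X)
     \<and> (\<forall>X\<subseteq>verts G. cut G X \<noteq> {} \<longrightarrow> \<not> cut G X \<subset> C)"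

text \<open>Replacing \<open>X\<close> by its complement gives the opposite signing of the same cut.\<close>

definition signed_elementary_cuts :: "('v, 'e) pre_digraph \<Rightarrow> ('e set \<times> 'e set) set" where
  "signed_elementary_cuts G =
     {(arcs_from_to G X (verts G - X), arcs_from_to G (verts G - X) X) | X.
        X \<subseteq> verts G \<and> elementary_cut G (cut G X)}"

definition represents_oriented_dual ::
    "('e \<Rightarrow> int ^ 'n) \<Rightarrow> ('v, 'e) pre_digraph \<Rightarrow> bool" where
  "represents_oriented_dual a G \<longleftrightarrow> signed_circuits (arcs G) a = signed_elementary_cuts G"

section \<open>Root polytope and Ehrhart theory\<close>

definition root_polytope :: "'e set \<Rightarrow> ('e \<Rightarrow> int ^ 'n) \<Rightarrow> (real ^ 'n) set" where
  "root_polytope E a = convex hull (real_col a ` E)"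

definition ehrhart :: "(real ^ 'n) set \<Rightarrow> nat \<Rightarrow> nat" where
  "ehrhart P t = card ((\<lambda>x. real t *\<^sub>R x) ` P \<inter> {x. \<forall>i. x $ i \<in> \<int>})"

text \<open>
  For a nonempty lattice polytope of dimension \<open>d\<close> the binomials \<open>(t + d - k) choose d\<close>,
  \<open>k \<le> d\<close>, form a basis of the polynomials in \<open>t\<close> of degree at most \<open>d\<close>, so the description
  determines the polynomial.  The empty polytope (dimension -1), which is the root polytope of the
  graph with one vertex and no arcs, has Ehrhart series 1 by the usual convention.
\<close>

definition h_star :: "(real ^ 'n) set \<Rightarrow> real poly" where
  "h_star P = (if P = {} then 1 else
     (let d = nat (aff_dim P) in
      THE h. degree h \<le> d \<and>
        (\<forall>t. real (ehrhart P t) = (\<Sum>k\<le>d. coeff h k * real ((t + d - k) choose d)))))"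

end

theory Submission
  imports Defs
begin

text \<open>
  Write \<open>m = |E|\<close>, \<open>n = |V|\<close> and \<open>d = m - n\<close>, and send a weight \<open>x \<in> \<real>\<^sup>E\<close> to the combination
  \<open>\<Sum>\<^sub>e x\<^sub>e a\<^sub>e\<close> of the columns.  The proof counts the lattice points of \<open>t \<cdot> Q\<close> directly, through a
  normal form for the preimages of a point, and avoids triangulations and shellings.

  The kernel of this map consists of the potential differences \<open>e \<mapsto> p (head e) - p (tail e)\<close>:
  the circuits are the elementary cuts, and by total unimodularity the coefficients of a circuit
  are \<open>\<plusminus>1\<close> up to a common factor, so both spaces are spanned by the indicator vectors of elementary
  cuts (\<open>comb_pot_diff\<close>, \<open>comb_eq_0_imp_pot_diff\<close>).  In an Eulerian digraph potential differences
  have coordinate sum 0.  Hence the points of \<open>t \<cdot> Q\<close> are the nonnegative weights of sum \<open>t\<close> modulo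
  potential differences.

  Read a nonnegative weight as arc lengths.  Adding the potential difference that belongs to the
  negated distances from the root makes every shortest path from the root have length 0, so each
  class has a representative whose zero arcs contain a spanning branching from the root
  (\<open>reduced_weight_exists\<close>).  It is unique, since two such representatives have all distances 0
  (\<open>reduced_weight_unique\<close>).  The support of a reduced weight is a face of the dual complex, and
  the columns indexed by a face are linearly independent; by total unimodularity a reduced weight
  over a lattice point is thus integral.  So the lattice points of \<open>t \<cdot> Q\<close> correspond to the
  functions \<open>E \<Rightarrow> \<nat>\<close> of sum \<open>t\<close> whose support is a face
  (\<open>ehrhart_eq_card_reduced_weights\<close>): the Ehrhart function is the Hilbert function of the
  Stanley-Reisner ring of the dual complex, and its h-star polynomial is the reversed h-polynomial.

  One point of care remains: the h-star polynomial must have degree at most \<open>d\<close>, whereas the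
  numerator read off from all faces may a priori have degree \<open>d + 1\<close>.  A path from the root
  need not return to it, so whether a set of arcs spans from the root does not depend on an arc \<open>c\<close>
  that ends there, and the dual complex is a cone with apex \<open>c\<close> (\<open>faces_eq_cone\<close>).  With the sums
  running over the faces \<open>T\<close> of the base of the cone,
  \<open>|t Q \<inter> \<int>\<^sup>n| = \<Sum>\<^sub>T (t choose |T|)\<close>, \<open>h\<^sup>* (x) = \<Sum>\<^sub>T x\<^bsup>|T|\<^esup> (1 - x)\<^bsup>d - |T|\<^esup>\<close> and
  \<open>\<lambda> (t) = \<Sum>\<^sub>T t (t - 1)\<^bsup>d - |T|\<^esup>\<close>, which gives the theorem term by term.
\<close>

section \<open>Counting compositions, and the binomial basis of the h-star polynomial\<close>

text \<open>
  The part \<open>e\<close>, which may be 0, takes up slack: it turns the usual \<open>t - 1 choose |T| - 1\<close> into a formula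
  that also holds for \<open>t = 0\<close> and for \<open>T = {}\<close>.
\<close>

lemma card_positive_compositions:
  assumes "finite T" "e \<notin> T"
  shows "finite {x :: 'e \<Rightarrow> nat. (\<forall>f\<in>T. 0 < x f) \<and> (\<forall>f. f \<notin> insert e T \<longrightarrow> x f = 0) \<and> sum x (insert e T) = t}
    \<and> card {x :: 'e \<Rightarrow> nat. (\<forall>f\<in>T. 0 < x f) \<and> (\<forall>f. f \<notin> insert e T \<longrightarrow> x f = 0) \<and> sum x (insert e T) = t}
        = t choose card T"
proof -
  define A where "A T t = {x :: 'e \<Rightarrow> nat. (\<forall>f\<in>T. 0 < x f) \<and> (\<forall>f. f \<notin> insert e T \<longrightarrow> x f = 0) \<and> sum x (insert e T) = t}"
    for T t
  have "finite (A T t) \<and> card (A T t) = t choose card T"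
    using assms
  proof (induction T arbitrary: t rule: finite_induct)
    case empty
    have "A {} t = {(\<lambda>_. 0)(e := t)}"
      by (auto simp: A_def fun_eq_iff)
    then show ?case by simp
  next
    case (insert f T)
    then have fe: "f \<noteq> e" "f \<notin> insert e T" "e \<notin> T" by auto
    have total: "sum x (insert e (insert f T)) = x f + sum x (insert e T)" for x :: "'e \<Rightarrow> nat"
      using insert.hyps fe by (simp add: insert_commute)
    have upd: "sum (x(f := j)) (insert e T) = sum x (insert e T)" for x :: "'e \<Rightarrow> nat" and j
      using fe by (intro sum.cong) auto
    have mem: "x \<in> A (insert f T) t \<longleftrightarrow> (\<forall>g\<in>T. 0 < x g) \<and> 0 < x f \<and>
        (\<forall>g. g \<notin> insert e T \<longrightarrow> g \<noteq> f \<longrightarrow> x g = 0) \<and> x f + sum x (insert e T) = t" for x t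
      unfolding A_def mem_Collect_eq total by auto
    show ?case
    proof (induction t)
      case 0
      have "A (insert f T) 0 = {}" using mem by auto
      then show ?case using insert.hyps by simp
    next
      case (Suc t)
      define P where "P = (\<lambda>x :: 'e \<Rightarrow> nat. x(f := 1)) ` A T t"
      define Q where "Q = (\<lambda>x :: 'e \<Rightarrow> nat. x(f := Suc (x f))) ` A (insert f T) t"
      have IH: "finite (A T t)" "card (A T t) = t choose card T"
        using insert.IH fe by auto
      \<comment> \<open>Split by whether the part at \<open>f\<close> is 1 or larger: Pascal's rule.\<close>
      have split: "A (insert f T) (Suc t) = P \<union> Q"
      proof (intro equalityI subsetI)
        fix x assume x: "x \<in> A (insert f T) (Suc t)"
        show "x \<in> P \<union> Q"
        proof (cases "x f = 1")
          case True
          have "x(f := 0) \<in> A T t"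
            using x[unfolded mem] True fe unfolding A_def mem_Collect_eq upd by auto
          moreover have "x = (x(f := 0))(f := 1)" using True by auto
          ultimately show ?thesis unfolding P_def by blast
        next
          case False
          have "x(f := x f - 1) \<in> A (insert f T) t"
            using x False fe unfolding mem upd by auto
          moreover have "x = (x(f := x f - 1))(f := Suc ((x(f := x f - 1)) f))"
            using x unfolding mem by auto
          ultimately show ?thesis unfolding Q_def by blast
        qed
      next
        fix x assume "x \<in> P \<union> Q"
        then show "x \<in> A (insert f T) (Suc t)"
        proof
          assume "x \<in> P"
          then obtain y where "y \<in> A T t" "x = y(f := 1)" unfolding P_def by blast
          then show ?thesis unfolding mem using fe upd unfolding A_def by auto
        next
          assume "x \<in> Q"
          then obtain y where "y \<in> A (insert f T) t" "x = y(f := Suc (y f))" unfolding Q_def by blast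
          then show ?thesis using fe unfolding mem by (auto simp del: fun_upd_apply simp add: upd) (auto)
        qed
      qed
      have "x f = 1" if "x \<in> P" for x using that unfolding P_def by auto
      moreover have "x f > 1" if "x \<in> Q" for x using that unfolding Q_def by (auto simp: mem)
      ultimately have disj: "P \<inter> Q = {}" by fastforce
      have injP: "inj_on (\<lambda>x :: 'e \<Rightarrow> nat. x(f := 1)) (A T t)"
      proof (rule inj_onI)
        fix x y assume xy: "x \<in> A T t" "y \<in> A T t" and eq: "x(f := 1) = y(f := 1)"
        have "x f = 0" "y f = 0" using xy fe by (auto simp: A_def)
        then show "x = y" using eq by (metis fun_upd_triv fun_upd_upd)
      qed
      have injQ: "inj_on (\<lambda>x :: 'e \<Rightarrow> nat. x(f := Suc (x f))) (A (insert f T) t)"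
        by (rule inj_onI) (metis fun_upd_eqD fun_upd_triv fun_upd_upd nat.inject)
      have "card (A (insert f T) (Suc t)) = card P + card Q"
        unfolding split using IH Suc.IH disj by (intro card_Un_disjoint) (auto simp: P_def Q_def)
      also have "\<dots> = (t choose card T) + (t choose card (insert f T))"
        using IH Suc.IH unfolding P_def Q_def card_image[OF injP] card_image[OF injQ] by simp
      finally show ?case
        using IH Suc.IH insert.hyps unfolding split by (auto simp: P_def Q_def)
    qed
  qed
  then show ?thesis unfolding A_def .
qed

text \<open>
  The value at \<open>t\<close> of the Ehrhart polynomial of a \<open>d\<close>-dimensional polytope with h-star polynomial
  \<open>h\<close>.
\<close>

definition from_h_vector :: "nat \<Rightarrow> real poly \<Rightarrow> nat \<Rightarrow> real" where
  "from_h_vector d h t = (\<Sum>k\<le>d. coeff h k * real ((t + d - k) choose d))"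

lemma from_h_vector_sum: "from_h_vector d (\<Sum>i\<in>I. h i) t = (\<Sum>i\<in>I. from_h_vector d (h i) t)"
  unfolding from_h_vector_def coeff_sum sum_distrib_right by (rule sum.swap)

text \<open>
  The same function of \<open>t\<close> written for dimension \<open>d + 1\<close>: in terms of generating series, numerator
  and denominator of \<open>h / (1 - x)\<^bsup>d + 1\<^esup>\<close> are multiplied by \<open>1 - x\<close>.  It is Pascal's rule,
  summed by parts.
\<close>

lemma from_h_vector_diff_step:
  assumes "degree h \<le> d"
  shows "from_h_vector (Suc d) ([:1, -1:] * h) t = from_h_vector d h t"
proof -
  have c0: "coeff h (Suc d) = 0" using assms by (simp add: coeff_eq_0)
  let ?b = "\<lambda>k. real ((t + Suc d - k) choose Suc d)"
  have "from_h_vector (Suc d) ([:1, -1:] * h) t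
      = (\<Sum>k\<le>Suc d. coeff h k * ?b k) - (\<Sum>k\<le>Suc d. (if k = 0 then 0 else coeff h (k - 1)) * ?b k)"
    unfolding from_h_vector_def sum_subtractf[symmetric]
    by (intro sum.cong refl) (auto simp: coeff_pCons algebra_simps split: nat.split)
  also have "(\<Sum>k\<le>Suc d. (if k = 0 then 0 else coeff h (k - 1)) * ?b k) = (\<Sum>k\<le>d. coeff h k * ?b (Suc k))"
    unfolding sum.atMost_Suc_shift by simp
  also have "(\<Sum>k\<le>Suc d. coeff h k * ?b k) = (\<Sum>k\<le>d. coeff h k * ?b k)"
    using c0 by simp
  also have "(\<Sum>k\<le>d. coeff h k * ?b k) - (\<Sum>k\<le>d. coeff h k * ?b (Suc k)) = from_h_vector d h t"
    unfolding from_h_vector_def sum_subtractf[symmetric]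
    by (intro sum.cong refl) (auto simp: Suc_diff_le algebra_simps)
  finally show ?thesis .
qed

lemma degree_face_poly: "s \<le> d \<Longrightarrow> degree (monom 1 s * [:1, -1:] ^ (d - s) :: real poly) \<le> d"
  using degree_mult_le[of "monom 1 s :: real poly" "[:1, -1:] ^ (d - s)"]
  by (simp add: degree_monom_eq degree_power_eq)

lemma from_h_vector_face:
  assumes "s \<le> d"
  shows "from_h_vector d (monom 1 s * [:1, -1:] ^ (d - s)) t = real (t choose s)"
  using assms
proof (induction d rule: dec_induct)
  case base
  have "from_h_vector s (monom 1 s) t = (\<Sum>k\<le>s. if k = s then real (t choose s) else 0)"
    unfolding from_h_vector_def by (intro sum.cong) auto
  then show ?case by (simp add: one_poly_def[symmetric])
next
  case (step d)
  have "monom 1 s * [:1, -1:] ^ (Suc d - s) = [:1, -1:] * (monom 1 s * [:1, -1:] ^ (d - s) :: real poly)"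
    using step.hyps by (simp only: Suc_diff_le power_Suc ac_simps)
  then show ?case
    using from_h_vector_diff_step[OF degree_face_poly] step by simp
qed

text \<open>
  At \<open>t \<le> d\<close> the binomials with index above \<open>t\<close> vanish and the one with index \<open>t\<close> is 1, so the
  values at \<open>0, \<dots>, d\<close> determine the coefficients by a triangular system.
\<close>

lemma from_h_vector_inject:
  assumes "degree g \<le> d" "degree h \<le> d" "\<And>t. from_h_vector d g t = from_h_vector d h t"
  shows "g = h"
proof -
  have tri: "from_h_vector d f t = (\<Sum>k<t. coeff f k * real ((t + d - k) choose d)) + coeff f t"
    if "t \<le> d" for f t
  proof -
    have "from_h_vector d f t = (\<Sum>k\<le>t. coeff f k * real ((t + d - k) choose d))"
      unfolding from_h_vector_def using that
      by (intro sum.mono_neutral_right) (auto simp: binomial_eq_0)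
    then show ?thesis by (simp add: lessThan_Suc_atMost[symmetric])
  qed
  have "coeff g t = coeff h t" if "t \<le> d" for t
    using that
  proof (induction t rule: less_induct)
    case (less t)
    have "(\<Sum>k<t. coeff g k * real ((t + d - k) choose d)) = (\<Sum>k<t. coeff h k * real ((t + d - k) choose d))"
      using less by (intro sum.cong) auto
    then show ?case using tri[OF less.prems] assms(3)[of t] by (metis add_left_cancel)
  qed
  moreover have "coeff g t = coeff h t" if "\<not> t \<le> d" for t
    using that assms by (simp add: coeff_eq_0)
  ultimately show ?thesis by (intro poly_eqI) blast
qed

section \<open>Integrality for totally unimodular families\<close>

lemma det_Ints:
  fixes A :: "real mat"
  assumes "A \<in> carrier_mat n n" "\<And>i j. i < n \<Longrightarrow> j < n \<Longrightarrow> A $$ (i, j) \<in> \<int>"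
  shows "Determinant.det A \<in> \<int>"
proof -
  have "signof p * (\<Prod>i = 0..<n. A $$ (i, p i)) \<in> \<int>" if "p permutes {0..<n}" for p
  proof (intro Ints_mult Ints_prod)
    show "signof p \<in> (\<int> :: real set)" by (simp add: sign_def)
    show "A $$ (i, p i) \<in> \<int>" if "i \<in> {0..<n}" for i
      using assms(2)[of i "p i"] that permutes_in_image[OF \<open>p permutes {0..<n}\<close>, of i] by auto
  qed
  then show ?thesis unfolding det_def'[OF assms(1)] by (intro Ints_sum) auto
qed

text \<open>
  Rank by minors, for columns \<open>b j\<close> that are linearly independent as a family: rows are added one
  at a time so that the leading minors stay nonzero.
\<close>

lemma nonsingular_rows_exist:
  fixes b :: "nat \<Rightarrow> 'n :: finite \<Rightarrow> real"
  assumes indep: "\<And>q. (\<And>i. (\<Sum>j<k. q j * b j i) = 0) \<Longrightarrow> \<forall>j<k. q j = 0"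
  shows "\<exists>r :: nat \<Rightarrow> 'n. inj_on r {..<k} \<and> Determinant.det (Matrix.mat k k (\<lambda>(i, j). b j (r i))) \<noteq> 0"
proof -
  have "\<exists>r :: nat \<Rightarrow> 'n. inj_on r {..<m} \<and> Determinant.det (Matrix.mat m m (\<lambda>(i, j). b j (r i))) \<noteq> 0"
    if "m \<le> k" for m
    using that
  proof (induction m)
    case 0
    then show ?case by simp
  next
    case (Suc m)
    then obtain r :: "nat \<Rightarrow> 'n" where
      r: "inj_on r {..<m}" "Determinant.det (Matrix.mat m m (\<lambda>(i, j). b j (r i))) \<noteq> 0" by auto
    define M where "M \<rho> = Matrix.mat (Suc m) (Suc m) (\<lambda>(i, j). b j ((r(m := \<rho>)) i))" for \<rho>
    have M: "M \<rho> \<in> carrier_mat (Suc m) (Suc m)" for \<rho> by (simp add: M_def)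
    \<comment> \<open>The cofactors of the last row do not depend on that row.  Were all the determinants
      zero, the cofactors would be the coefficients of a linear dependence.\<close>
    define q where "q j = (if j \<le> m then cofactor (M undefined) m j else 0)" for j
    have cof: "cofactor (M \<rho>) m j = q j" if "j < Suc m" for \<rho> j
    proof -
      have "mat_delete (M \<rho>) m j = mat_delete (M undefined) m j"
        by (rule eq_matI) (auto simp: mat_delete_def M_def)
      then show ?thesis using that by (simp add: cofactor_def q_def)
    qed
    have "mat_delete (M undefined) m m = Matrix.mat m m (\<lambda>(i, j). b j (r i))"
      by (rule eq_matI) (auto simp: mat_delete_def M_def)
    then have qm: "q m \<noteq> 0" using r(2) by (simp add: q_def cofactor_def)
    have expand: "Determinant.det (M \<rho>) = (\<Sum>j<Suc m. q j * b j \<rho>)" for \<rho>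
      unfolding laplace_expansion_row[OF M lessI]
      by (intro sum.cong refl) (simp add: cof, simp add: M_def)
    have "\<exists>\<rho>. Determinant.det (M \<rho>) \<noteq> 0"
    proof (rule ccontr)
      assume "\<not> ?thesis"
      then have "(\<Sum>j<Suc m. q j * b j \<rho>) = 0" for \<rho> using expand by metis
      moreover have "(\<Sum>j<k. q j * b j \<rho>) = (\<Sum>j<Suc m. q j * b j \<rho>)" for \<rho>
        using Suc.prems by (intro sum.mono_neutral_right) (auto simp: q_def)
      ultimately have "\<forall>j<k. q j = 0" using indep by metis
      then show False using qm Suc.prems by auto
    qed
    then obtain \<rho> where \<rho>: "Determinant.det (M \<rho>) \<noteq> 0" by blast
    have "\<rho> \<notin> r ` {..<m}"
    proof
      assume "\<rho> \<in> r ` {..<m}"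
      then obtain i where i: "i < m" "r i = \<rho>" by auto
      have "Matrix.row (M \<rho>) i = Matrix.row (M \<rho>) m"
        by (rule eq_vecI) (use i in \<open>auto simp: M_def\<close>)
      then have "Determinant.det (M \<rho>) = 0"
        using i by (intro Determinant.det_identical_rows[OF M, of i m]) auto
      then show False using \<rho> by simp
    qed
    then have "inj_on (r(m := \<rho>)) {..<Suc m}"
      using r(1) by (auto simp: lessThan_Suc inj_on_def)
    then show ?case using \<rho> unfolding M_def by blast
  qed
  then show ?thesis by blast
qed

text \<open>
  Cramer's rule for a square system of nonsingular rows, whose determinant is \<open>\<plusminus>1\<close>.
\<close>

lemma totally_unimodular_integral_coefficients:
  fixes a :: "'e \<Rightarrow> int ^ 'n"
  assumes tu: "totally_unimodular E a" and "finite D" "D \<subseteq> E"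
    and indep: "\<not> lin_dependent_family a D"
    and int: "\<And>i. (\<Sum>e\<in>D. x e *\<^sub>R real_col a e) $ i \<in> \<int>"
    and "e \<in> D"
  shows "x e \<in> \<int>"
proof -
  define k where "k = card D"
  obtain c where c: "bij_betw c {..<k} D"
    using ex_bij_betw_nat_finite[OF \<open>finite D\<close>] unfolding k_def atLeast0LessThan by blast
  have cD: "c j \<in> D" if "j < k" for j using c that by (auto simp: bij_betw_def)
  have comb: "(\<Sum>e\<in>D. y e *\<^sub>R real_col a e) $ i = (\<Sum>j<k. y (c j) * real_of_int (a (c j) $ i))" for y i
    by (simp add: sum.reindex_bij_betw[OF c, symmetric] real_col_def)
  have "\<exists>r :: nat \<Rightarrow> 'n. inj_on r {..<k} \<and>
      Determinant.det (Matrix.mat k k (\<lambda>(i, j). real_of_int (a (c j) $ r i))) \<noteq> 0"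
  proof (rule nonsingular_rows_exist)
    fix q assume q: "\<And>i. (\<Sum>j<k. q j * real_of_int (a (c j) $ i)) = 0"
    define y where "y e = q (the_inv_into {..<k} c e)" for e
    have yc: "y (c j) = q j" if "j < k" for j
      using that c by (simp add: y_def the_inv_into_f_f bij_betw_def)
    have "(\<Sum>e\<in>D. y e *\<^sub>R real_col a e) = 0"
      unfolding Finite_Cartesian_Product.vec_eq_iff comb using q by (simp add: yc)
    then show "\<forall>j<k. q j = 0"
      using indep cD yc unfolding lin_dependent_family_def by metis
  qed
  then obtain r :: "nat \<Rightarrow> 'n" where r: "inj_on r {..<k}" and
    nz: "Determinant.det (Matrix.mat k k (\<lambda>(i, j). real_of_int (a (c j) $ r i))) \<noteq> 0" by blast
  let ?M = "Matrix.mat k k (\<lambda>(i, j). real_of_int (a (c j) $ r i))"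
  let ?I = "Matrix.mat k k (\<lambda>(i, j). a (c j) $ r i)"
  have "Determinant.det ?I \<in> {0, 1, -1}"
    using tu r c \<open>D \<subseteq> E\<close> unfolding totally_unimodular_def bij_betw_def by blast
  moreover have "?M = map_mat real_of_int ?I" by (rule eq_matI) auto
  then have "Determinant.det ?M = real_of_int (Determinant.det ?I)"
    by (simp add: of_int_hom.hom_det)
  ultimately have det: "Determinant.det ?M = 1 \<or> Determinant.det ?M = -1" using nz by auto
  define X where "X = Matrix.vec k (\<lambda>j. x (c j))"
  have X: "X \<in> carrier_vec k" and M: "?M \<in> carrier_mat k k" by (auto simp: X_def)
  have MX: "Matrix.vec_index (?M *\<^sub>v X) i = (\<Sum>e\<in>D. x e *\<^sub>R real_col a e) $ r i" if "i < k" for i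
    using that unfolding comb
    by (auto simp: X_def scalar_prod_def atLeast0LessThan mult.commute intro!: sum.cong)
  obtain j where j: "j < k" "c j = e" using c \<open>e \<in> D\<close> by (auto simp: bij_betw_def)
  have "Determinant.det (replace_col ?M (?M *\<^sub>v X) j) \<in> \<int>"
  proof (rule det_Ints[where n = k])
    show "replace_col ?M (?M *\<^sub>v X) j \<in> carrier_mat k k" by (simp add: replace_col_def)
    fix i l assume "i < k" "l < k"
    then show "replace_col ?M (?M *\<^sub>v X) j $$ (i, l) \<in> \<int>"
      using MX[of i] int[of "r i"] by (simp add: replace_col_def del: sum_component)
  qed
  then have "Matrix.vec_index X j * Determinant.det ?M \<in> \<int>"
    unfolding cramer_lemma_mat[OF M X j(1)] .
  then show ?thesis using det j by (auto simp: X_def)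
qed

lemma lin_dependent_family_contains_circuit:
  assumes "lin_dependent_family a D" "finite D" "D \<subseteq> E"
  shows "\<exists>C\<subseteq>D. is_circuit E a C"
proof -
  define K where "K = {C. C \<subseteq> D \<and> lin_dependent_family a C}"
  have "finite K" "D \<in> K" using assms by (auto simp: K_def)
  then obtain C where "C \<in> K" and min: "\<And>C'. C' \<in> K \<Longrightarrow> C' \<subseteq> C \<Longrightarrow> C = C'"
    using finite_has_minimal[of K] by auto
  then have "is_circuit E a C"
    using assms(3) unfolding is_circuit_def K_def by blast
  then show ?thesis using \<open>C \<in> K\<close> unfolding K_def by blast
qed

lemma circuit_coefficients_nonzero:
  assumes "is_circuit E a C" "finite C" "(\<Sum>e\<in>C. l e *\<^sub>R real_col a e) = 0" "f \<in> C" "l f \<noteq> 0" "e \<in> C"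
  shows "l e \<noteq> 0"
proof
  assume "l e = 0"
  then have "(\<Sum>g\<in>C - {e}. l g *\<^sub>R real_col a g) = 0"
    using assms(2,3,6) by (simp add: sum.remove[of C e])
  moreover have "f \<in> C - {e}" using assms \<open>l e = 0\<close> by auto
  ultimately have "lin_dependent_family a (C - {e})"
    using assms(5) unfolding lin_dependent_family_def by blast
  then show False using assms(1,6) unfolding is_circuit_def by blast
qed

text \<open>
  Dividing a dependence of a circuit by one of its coefficients expresses an integral vector by the
  remaining, linearly independent columns.  All the quotients of two coefficients are therefore
  integers, and so are their inverses.
\<close>

lemma totally_unimodular_circuit_coefficients:
  assumes tu: "totally_unimodular E a" and C: "is_circuit E a C" "finite C"
    and l: "(\<Sum>e\<in>C. l e *\<^sub>R real_col a e) = 0" "\<And>e. e \<in> C \<Longrightarrow> l e \<noteq> 0"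
    and ef: "e \<in> C" "f \<in> C"
  shows "\<bar>l e\<bar> = \<bar>l f\<bar>"
proof -
  have quotient: "l f / l e \<in> \<int>" if "e \<in> C" "f \<in> C" "e \<noteq> f" for e f
  proof (rule totally_unimodular_integral_coefficients[OF tu, where D = "C - {e}" and x = "\<lambda>g. l g / l e"])
    show "C - {e} \<subseteq> E" "\<not> lin_dependent_family a (C - {e})"
      using C that unfolding is_circuit_def by blast+
    have "l e *\<^sub>R real_col a e + (\<Sum>g\<in>C - {e}. l g *\<^sub>R real_col a g) = 0"
      using l(1) C(2) that by (simp add: sum.remove[of C e])
    then have "(\<Sum>g\<in>C - {e}. l g *\<^sub>R real_col a g) = - (l e *\<^sub>R real_col a e)"
      by (simp add: eq_neg_iff_add_eq_0 add.commute)
    moreover have "(\<Sum>g\<in>C - {e}. (l g / l e) *\<^sub>R real_col a g) = (1 / l e) *\<^sub>R (\<Sum>g\<in>C - {e}. l g *\<^sub>R real_col a g)"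
      unfolding scaleR_right.sum by simp
    ultimately show "(\<Sum>g\<in>C - {e}. (l g / l e) *\<^sub>R real_col a g) $ i \<in> \<int>" for i
      using l(2)[OF that(1)] by (simp add: real_col_def)
  qed (use C that in auto)
  show ?thesis
  proof (cases "e = f")
    case False
    obtain i where i: "l f / l e = real_of_int i" using quotient[of e f] ef False by (auto elim: Ints_cases)
    obtain j where j: "l e / l f = real_of_int j" using quotient[of f e] ef False by (auto elim: Ints_cases)
    have "real_of_int (i * j) = (l f / l e) * (l e / l f)" using i j by simp
    also have "\<dots> = 1" using l(2)[OF ef(1)] l(2)[OF ef(2)] by simp
    finally have "i * j = 1" by linarith
    then have "\<bar>i\<bar> = 1" by (metis abs_mult abs_one abs_zmult_eq_1)
    then have "\<bar>l f / l e\<bar> = 1" using i by simp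
    then show ?thesis using l(2)[OF ef(1)] by (simp add: field_simps)
  qed simp
qed

section \<open>Spanning branchings and the bases of the branching greedoid\<close>

definition arc_rel :: "('v, 'e) pre_digraph \<Rightarrow> 'e set \<Rightarrow> ('v \<times> 'v) set" where
  "arc_rel G Z = (\<lambda>e. (tail G e, head G e)) ` Z"

definition sym_rel :: "('v, 'e) pre_digraph \<Rightarrow> 'e set \<Rightarrow> ('v \<times> 'v) set" where
  "sym_rel G Z = arc_rel G Z \<union> (arc_rel G Z)\<inverse>"

definition spans_from :: "('v, 'e) pre_digraph \<Rightarrow> 'v \<Rightarrow> 'e set \<Rightarrow> bool" where
  "spans_from G r Z \<longleftrightarrow> (\<forall>v\<in>verts G. (r, v) \<in> (arc_rel G Z)\<^sup>*)"

text \<open>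
  Arborescences together with their vertex sets, grown from the root by adding one leaf at a time.
  Every property needed below has an induction along this growth.
\<close>

inductive branching :: "('v, 'e) pre_digraph \<Rightarrow> 'v \<Rightarrow> 'e set \<Rightarrow> 'v set \<Rightarrow> bool"
  for G :: "('v, 'e) pre_digraph" and r :: 'v where
  root: "branching G r {} {r}"
| grow: "branching G r B W \<Longrightarrow> e \<in> arcs G \<Longrightarrow> tail G e \<in> W \<Longrightarrow> head G e \<notin> W \<Longrightarrow>
    branching G r (insert e B) (insert (head G e) W)"

lemma arc_relI: "e \<in> Z \<Longrightarrow> (tail G e, head G e) \<in> arc_rel G Z"
  by (auto simp: arc_rel_def)

lemma arc_rel_mono: "Y \<subseteq> Z \<Longrightarrow> arc_rel G Y \<subseteq> arc_rel G Z"
  by (auto simp: arc_rel_def)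

lemma sym_rel_mono: "Y \<subseteq> Z \<Longrightarrow> sym_rel G Y \<subseteq> sym_rel G Z"
  by (auto simp: arc_rel_def sym_rel_def)

lemma sym_rel_rtrancl_sym:
  assumes "(u, v) \<in> (sym_rel G Z)\<^sup>*"
  shows "(v, u) \<in> (sym_rel G Z)\<^sup>*"
proof -
  have "sym (sym_rel G Z)" by (auto simp: sym_def sym_rel_def)
  then show ?thesis using assms by (rule symD[OF sym_rtrancl])
qed

lemma arc_rel_rtrancl_sym_rel:
  assumes "(u, v) \<in> (arc_rel G Y)\<^sup>*" "Y \<subseteq> Z"
  shows "(u, v) \<in> (sym_rel G Z)\<^sup>*"
proof -
  have "arc_rel G Y \<subseteq> sym_rel G Z" using assms(2) by (auto simp: arc_rel_def sym_rel_def)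
  then show ?thesis using assms(1) rtrancl_mono by blast
qed

lemma spans_from_mono: "spans_from G r Y \<Longrightarrow> Y \<subseteq> Z \<Longrightarrow> spans_from G r Z"
  unfolding spans_from_def using rtrancl_mono[OF arc_rel_mono] by blast

lemma same_component_iff:
  assumes "wf_digraph F"
  shows "same_component F u v \<longleftrightarrow> u \<in> verts F \<and> (u, v) \<in> (sym_rel F (arcs F))\<^sup>*"
proof -
  interpret wf_digraph F by fact
  have ends: "arcs_ends (with_proj (mk_symmetric F)) = sym_rel F (arcs F)"
    by (auto simp: mk_symmetric_def arcs_ends_def arc_to_ends_def sym_rel_def arc_rel_def)
  have "wf_digraph (with_proj (mk_symmetric F))"
    by unfold_locales (auto simp: mk_symmetric_def)
  then show ?thesis
    unfolding same_component_def
    using wf_digraph.reachable_conv'[of "with_proj (mk_symmetric F)" u v]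
      reachable_in_vertsE[of "with_proj (mk_symmetric F)" u v]
    unfolding ends by (auto simp: mk_symmetric_def)
qed

lemma connected_iff:
  assumes "wf_digraph F"
  shows "Digraph_Component.connected F \<longleftrightarrow>
    verts F \<noteq> {} \<and> (\<forall>u\<in>verts F. \<forall>v\<in>verts F. (u, v) \<in> (sym_rel F (arcs F))\<^sup>*)"
  using same_component_iff[OF assms]
  by (auto simp: Digraph_Component.connected_def strongly_connected_def same_component_def mk_symmetric_def)

lemma branching_arcs:
  assumes "branching G r B W"
  shows "B \<subseteq> arcs G" "finite B" "finite W" "r \<in> W" "card W = Suc (card B)"
    "\<And>e. e \<in> B \<Longrightarrow> tail G e \<in> W \<and> head G e \<in> W"
proof -
  have "B \<subseteq> arcs G \<and> finite B \<and> finite W \<and> r \<in> W \<and> card W = Suc (card B) \<and>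
      (\<forall>e\<in>B. tail G e \<in> W \<and> head G e \<in> W)"
    using assms
  proof induction
    case (grow B W e)
    then have "e \<notin> B" by blast
    then show ?case using grow by auto
  qed auto
  then show "B \<subseteq> arcs G" "finite B" "finite W" "r \<in> W" "card W = Suc (card B)"
    "\<And>e. e \<in> B \<Longrightarrow> tail G e \<in> W \<and> head G e \<in> W" by blast+
qed

lemma branching_reaches:
  "branching G r B W \<Longrightarrow> v \<in> W \<Longrightarrow> (r, v) \<in> (arc_rel G B)\<^sup>*"
proof (induction arbitrary: v rule: branching.induct)
  case (grow B W e)
  have mono: "(arc_rel G B)\<^sup>* \<subseteq> (arc_rel G (insert e B))\<^sup>*"
    by (intro rtrancl_mono arc_rel_mono) auto
  then have "(r, tail G e) \<in> (arc_rel G (insert e B))\<^sup>*" using grow by blast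
  then have "(r, head G e) \<in> (arc_rel G (insert e B))\<^sup>*"
    by (rule rtrancl_into_rtrancl) (simp add: arc_relI)
  then show ?case using grow mono by blast
qed auto

text \<open>
  A potential is extended to a new leaf in exactly one way that gives the new arc its prescribed
  value.  This is the dimension count for the root polytope and the reason why branchings have no
  cycles.
\<close>

lemma branching_potential:
  fixes x :: "'e \<Rightarrow> real"
  assumes "branching G r B W"
  shows "\<exists>p. \<forall>e\<in>B. p (head G e) - p (tail G e) = x e"
  using assms
proof induction
  case (grow B W e)
  then obtain p where p: "\<forall>e\<in>B. p (head G e) - p (tail G e) = x e" by blast
  have "tail G f \<noteq> head G e" "head G f \<noteq> head G e" if "f \<in> B" for f
    using branching_arcs(6)[OF grow.hyps(1) that] grow.hyps by auto
  moreover have "tail G e \<noteq> head G e" using grow.hyps by auto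
  ultimately show ?case
    using p by (intro exI[of _ "p(head G e := p (tail G e) + x e)"]) auto
qed auto

lemma (in wf_digraph) branching_verts:
  assumes "branching G r B W" "r \<in> verts G"
  shows "W \<subseteq> verts G"
  using assms by induction auto

lemma branching_maximal:
  assumes "finite Z" "Z \<subseteq> arcs G"
  shows "\<exists>B W. branching G r B W \<and> B \<subseteq> Z \<and> (\<forall>e\<in>Z. tail G e \<in> W \<longrightarrow> head G e \<in> W)"
proof -
  define K where "K = {B. B \<subseteq> Z \<and> (\<exists>W. branching G r B W)}"
  have "finite K" using assms by (simp add: K_def)
  moreover have "{} \<in> K" by (auto simp: K_def intro: branching.root)
  ultimately obtain B where "B \<in> K" and max: "\<And>B'. B' \<in> K \<Longrightarrow> B \<subseteq> B' \<Longrightarrow> B = B'"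
    using finite_has_maximal[of K] by auto
  then obtain W where B: "B \<subseteq> Z" and W: "branching G r B W" by (auto simp: K_def)
  have "head G e \<in> W" if "e \<in> Z" "tail G e \<in> W" for e
  proof (rule ccontr)
    assume "head G e \<notin> W"
    then have "branching G r (insert e B) (insert (head G e) W)" "e \<notin> B"
      using that W assms branching_arcs(6)[OF W] by (auto intro: branching.grow)
    moreover from this have "insert e B \<in> K" using B that by (auto simp: K_def)
    ultimately show False using max[of "insert e B"] by blast
  qed
  then show ?thesis using W B by blast
qed

lemma (in fin_digraph) spans_from_iff_branching:
  assumes "r \<in> verts G" "Z \<subseteq> arcs G"
  shows "spans_from G r Z \<longleftrightarrow> (\<exists>B\<subseteq>Z. branching G r B (verts G))"
proof
  assume span: "spans_from G r Z"
  obtain B W where B: "branching G r B W" "B \<subseteq> Z" "\<forall>e\<in>Z. tail G e \<in> W \<longrightarrow> head G e \<in> W"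
    using branching_maximal[OF finite_subset[OF assms(2) finite_arcs] assms(2), of r] by auto
  have "v \<in> W" if "(r, v) \<in> (arc_rel G Z)\<^sup>*" for v
    using that
    by induction (use B(3) branching_arcs(4)[OF B(1)] in \<open>auto simp: arc_rel_def\<close>)
  then have "W = verts G"
    using span branching_verts[OF B(1) assms(1)] by (auto simp: spans_from_def)
  then show "\<exists>B\<subseteq>Z. branching G r B (verts G)" using B by blast
next
  assume "\<exists>B\<subseteq>Z. branching G r B (verts G)"
  then obtain B where B: "B \<subseteq> Z" "branching G r B (verts G)" by blast
  then have "spans_from G r B"
    using branching_reaches[OF B(2)] by (auto simp: spans_from_def)
  then show "spans_from G r Z" using B(1) by (rule spans_from_mono)
qed

lemma bidirect_simps [simp]:
  "verts (bidirect F) = verts F" "arcs (bidirect F) = arcs F \<times> UNIV"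
  "tail (bidirect F) (e, b) = (if b then tail F e else head F e)"
  "head (bidirect F) (e, b) = (if b then head F e else tail F e)"
  by (auto simp: bidirect_def)

lemma wf_bidirect: "wf_digraph F \<Longrightarrow> wf_digraph (bidirect F)"
  by (auto simp: wf_digraph_def)

lemma bidirect_walk_telescope:
  fixes p :: "'v \<Rightarrow> real"
  assumes "pre_digraph.cas (bidirect F) u es w"
  shows "(\<Sum>(e, b)\<leftarrow>es. (if b then 1 else -1) * (p (head F e) - p (tail F e))) = p w - p u"
  using assms
  by (induction es arbitrary: u) (auto simp: pre_digraph.cas.simps split: if_splits)

text \<open>
  In a branching there is a potential that jumps along one prescribed arc only; summed around
  an undirected cycle through that arc it would not return to its initial value.
\<close>

lemma branching_no_undirected_cycle:
  assumes "branching G r B W" "arcs F = B" "tail F = tail G" "head F = head G"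
  shows "\<not> undirected_cycle F es"
proof
  assume "undirected_cycle F es"
  then obtain u where u: "pre_digraph.awalk (bidirect F) u es u" "es \<noteq> []" "distinct (map fst es)"
    by (auto simp: undirected_cycle_def pre_digraph.cycle_def)
  then obtain e b es' where es: "es = (e, b) # es'" by (metis list.exhaust prod.exhaust)
  have "set es \<subseteq> arcs (bidirect F)" using u(1) by (simp add: pre_digraph.awalk_def)
  then have B: "f \<in> B" if "(f, c) \<in> set es" for f c using that assms(2) by auto
  obtain p :: "_ \<Rightarrow> real" where
    p: "\<forall>f\<in>B. p (head G f) - p (tail G f) = (if f = e then 1 else 0)"
    using branching_potential[OF assms(1), of "\<lambda>f. if f = e then 1 else 0"] by blast
  have rest: "map (\<lambda>(f, c). (if c then 1 else -1) * (p (head F f) - p (tail F f))) es' = map (\<lambda>_. 0) es'"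
  proof (rule map_cong[OF refl])
    fix fc assume fc: "fc \<in> set es'"
    obtain f c where "fc = (f, c)" by force
    moreover from this have "f \<noteq> e" using u(3) es fc by force
    moreover have "f \<in> B" using B[of f c] es fc \<open>fc = (f, c)\<close> by auto
    ultimately show "(\<lambda>(f, c). (if c then 1 else -1) * (p (head F f) - p (tail F f))) fc = 0"
      using p assms by simp
  qed
  have "(\<Sum>(f, c)\<leftarrow>es'. (if c then 1 else -1) * (p (head F f) - p (tail F f))) = 0"
    unfolding rest by simp
  moreover have "p (head F e) - p (tail F e) = 1" using p B[of e b] es assms by auto
  moreover have "pre_digraph.cas (bidirect F) u es u" using u(1) by (simp add: pre_digraph.awalk_def)
  ultimately show False
    using bidirect_walk_telescope[of F u es u p] es by (auto split: if_splits)
qed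

text \<open>
  A path in \<open>bidirect F\<close> that used one arc in both directions would visit an end of it twice.
\<close>

lemma bidirect_apath_distinct_arcs:
  assumes "wf_digraph F" "pre_digraph.apath (bidirect F) u es w"
  shows "distinct (map fst es)"
  using assms(2)
proof (induction es arbitrary: u)
  case (Cons x es)
  interpret B: wf_digraph "bidirect F" using assms(1) by (rule wf_bidirect)
  obtain e b where x: "x = (e, b)" by force
  have path: "B.apath (head (bidirect F) x) es w" "tail (bidirect F) x \<notin> set (B.awalk_verts (head (bidirect F) x) es)"
    using Cons.prems by (auto simp: B.apath_Cons_iff)
  have "e \<notin> fst ` set es"
  proof
    assume "e \<in> fst ` set es"
    then obtain c where c: "(e, c) \<in> set es" by force
    have "tail (bidirect F) (e, c) \<in> set (B.awalk_verts (head (bidirect F) x) es)"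
      "head (bidirect F) (e, c) \<in> set (B.awalk_verts (head (bidirect F) x) es)"
      using B.awalk_verts_arc1[OF c] B.awalk_verts_arc2[OF _ c] path(1) by (auto simp: B.apath_def)
    then show False using path(2) x by (cases b; cases c) auto
  qed
  then show ?case using Cons.IH[OF path(1)] x by simp
qed simp

lemma undirected_cycle_through_arc:
  assumes wf: "wf_digraph F" and "e \<in> arcs F"
    and conn: "(head F e, tail F e) \<in> (sym_rel F (arcs F - {e}))\<^sup>*"
  shows "\<exists>es. undirected_cycle F es"
proof -
  interpret F: wf_digraph F by fact
  define D where "D = \<lparr>verts = verts F, arcs = arcs F - {e}, tail = tail F, head = head F\<rparr>"
  have D: "wf_digraph D" by unfold_locales (auto simp: D_def)
  interpret BD: wf_digraph "bidirect D" using D by (rule wf_bidirect)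
  interpret BF: wf_digraph "bidirect F" using wf by (rule wf_bidirect)
  have D_ends: "tail D = tail F" "head D = head F" by (auto simp: D_def)
  have compat: "compatible (bidirect F) (bidirect D)"
    unfolding compatible_def bidirect_def D_ends by simp
  have ends: "arcs_ends (bidirect D) = sym_rel F (arcs F - {e})"
  proof (intro equalityI subsetI)
    fix z assume "z \<in> sym_rel F (arcs F - {e})"
    then obtain f where "f \<in> arcs F - {e}" "z = (tail F f, head F f) \<or> z = (head F f, tail F f)"
      by (auto simp: sym_rel_def arc_rel_def)
    then have "(f, True) \<in> arcs (bidirect D)" "(f, False) \<in> arcs (bidirect D)"
      "z = arc_to_ends (bidirect D) (f, True) \<or> z = arc_to_ends (bidirect D) (f, False)"
      by (auto simp: arc_to_ends_def D_def)
    then show "z \<in> arcs_ends (bidirect D)" unfolding arcs_ends_def by blast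
  qed (auto simp: arcs_ends_def arc_to_ends_def sym_rel_def arc_rel_def D_def split: if_splits)
  have "head F e \<in> verts (bidirect D)" using assms by (simp add: D_def)
  then have "reachable (bidirect D) (head F e) (tail F e)"
    using conn ends BD.reachable_conv' by metis
  then obtain es where es: "BD.apath (head F e) es (tail F e)"
    using BD.reachable_apath by blast
  have walk: "BD.awalk (head F e) es (tail F e)" "distinct (BD.awalk_verts (head F e) es)"
    using es by (auto simp: BD.apath_def)
  have "set es \<subseteq> arcs (bidirect D)" using walk(1) by (simp add: BD.awalk_def)
  have verts: "BF.awalk_verts = BD.awalk_verts" "BF.cas = BD.cas"
    using compat compatible_awalk_verts compatible_cas by blast+
  have path: "BF.awalk (head F e) es (tail F e)"
    using walk(1) verts assms unfolding BF.awalk_def BD.awalk_def by (auto simp: D_def)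
  have "BF.awalk (tail F e) [(e, True)] (head F e)"
    using assms by (simp add: BF.awalk_simps)
  then have closed: "BF.awalk (head F e) (es @ [(e, True)]) (head F e)"
    using path by (metis BF.awalk_appendI)
  have "BF.awalk_verts (head F e) (es @ [(e, True)]) = BF.awalk_verts (head F e) es @ [head F e]"
    using BF.awlast_of_awalk[OF path] by (cases es) (auto simp: BF.awalk_verts_conv)
  moreover obtain vs where "BF.awalk_verts (head F e) es = head F e # vs"
    using BF.awhd_of_awalk[OF path] BF.awalk_verts_non_Nil by (metis list.collapse)
  ultimately have "distinct (tl (BF.awalk_verts (head F e) (es @ [(e, True)])))"
    using walk(2) unfolding verts(1)[symmetric] by simp
  moreover have "distinct (map fst es)"
    using bidirect_apath_distinct_arcs[OF D es] .
  moreover have "e \<notin> fst ` set es"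
    using \<open>set es \<subseteq> arcs (bidirect D)\<close> by (auto simp: D_def)
  ultimately have "undirected_cycle F (es @ [(e, True)])"
    using closed unfolding undirected_cycle_def BF.cycle_def by auto
  then show ?thesis by blast
qed

text \<open>
  Grown branchings are arborescences by induction.  Conversely, let \<open>W\<close> be the vertex set of a
  maximal branching inside an arborescence.  An arc leaving \<open>W\<close> could be added.  An arc entering
  \<open>W\<close> has its tail in the component of the root after its deletion, and so closes a cycle; so does
  an arc inside \<open>W\<close> that is not in the branching.
\<close>

lemma (in fin_digraph) branching_greedoid_bases_eq:
  assumes r: "r \<in> verts G"
  shows "branching_greedoid_bases G r = {B. branching G r B (verts G)}"
proof (intro equalityI subsetI)
  fix B assume "B \<in> {B. branching G r B (verts G)}"
  then have B: "branching G r B (verts G)" by simp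
  define F where "F = G\<lparr>arcs := B\<rparr>"
  have F: "verts F = verts G" "arcs F = B" "tail F = tail G" "head F = head G"
    by (auto simp: F_def)
  have wf: "wf_digraph F" using branching_arcs(1)[OF B] by unfold_locales (auto simp: F_def)
  have rel: "arc_rel F = arc_rel G" "sym_rel F = sym_rel G"
    by (auto simp: fun_eq_iff arc_rel_def sym_rel_def F)
  have sub: "subgraph F G"
    using branching_arcs(1)[OF B] wf wf_digraph by (auto simp: subgraph_def compatible_def F)
  have "(u, v) \<in> (sym_rel G B)\<^sup>*" if "u \<in> verts G" "v \<in> verts G" for u v
    using rtrancl_trans[OF sym_rel_rtrancl_sym[OF arc_rel_rtrancl_sym_rel[OF branching_reaches[OF B that(1)]]]
      arc_rel_rtrancl_sym_rel[OF branching_reaches[OF B that(2)]]] by simp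
  then have "undirected_tree F"
    using branching_no_undirected_cycle[OF B F(2-4)] r
    by (auto simp: undirected_tree_def connected_iff[OF wf] F rel)
  moreover have "same_component (pre_digraph.del_arc F e) r (tail F e)" if "e \<in> B" for e
  proof -
    have "(r, tail G e) \<in> (sym_rel G (B - {e}))\<^sup>*"
      using B that
    proof induction
      case (grow B W f)
      then have "f \<notin> B" using branching_arcs(6) by fastforce
      show ?case
      proof (cases "e = f")
        case True
        then have "insert f B - {e} = B" using \<open>f \<notin> B\<close> by auto
        then show ?thesis
          using arc_rel_rtrancl_sym_rel[OF branching_reaches[OF grow.hyps(1,3)] order_refl] True by simp
      next
        case False
        then show ?thesis
          using grow rtrancl_mono[OF sym_rel_mono[of "B - {e}" "insert f B - {e}" G]] by blast
      qed
    qed simp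
    moreover have "wf_digraph (pre_digraph.del_arc F e)"
      using wf by (simp add: pre_digraph.del_arc_def wf_digraph_def)
    moreover have "sym_rel (pre_digraph.del_arc F e) = sym_rel G"
      by (auto simp: fun_eq_iff arc_rel_def sym_rel_def F pre_digraph.del_arc_def)
    ultimately show ?thesis
      using r by (simp add: same_component_iff pre_digraph.del_arc_def F)
  qed
  ultimately have "arborescence G r F" "spanning F G"
    using sub r by (auto simp: arborescence_def spanning_def F)
  then show "B \<in> branching_greedoid_bases G r"
    unfolding branching_greedoid_bases_def using F(2) by blast
next
  fix A assume "A \<in> branching_greedoid_bases G r"
  then obtain F where A: "A = arcs F" and arb: "arborescence G r F" and span: "spanning F G"
    unfolding branching_greedoid_bases_def by blast
  have wf: "wf_digraph F" and F: "verts F = verts G" "arcs F \<subseteq> arcs G" "tail F = tail G" "head F = head G"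
    using span by (auto simp: spanning_def subgraph_def compatible_def)
  have rel: "arc_rel F = arc_rel G" "sym_rel F = sym_rel G"
    by (auto simp: fun_eq_iff arc_rel_def sym_rel_def F)
  have no_bypass: "(head G e, tail G e) \<notin> (sym_rel G (arcs F - {e}))\<^sup>*" if "e \<in> arcs F" for e
    using undirected_cycle_through_arc[OF wf that] arb
    by (auto simp: arborescence_def undirected_tree_def F rel)
  obtain B W where B: "branching G r B W" "B \<subseteq> arcs F"
    and closed: "\<forall>e\<in>arcs F. tail G e \<in> W \<longrightarrow> head G e \<in> W"
    using branching_maximal[OF finite_subset[OF F(2) finite_arcs] F(2), of r] by auto
  have conn: "(u, v) \<in> (sym_rel G Z)\<^sup>*" if "u \<in> W" "v \<in> W" "B \<subseteq> Z" for u v Z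
    using rtrancl_trans[OF sym_rel_rtrancl_sym[OF arc_rel_rtrancl_sym_rel[OF branching_reaches[OF B(1) that(1)] that(3)]]
      arc_rel_rtrancl_sym_rel[OF branching_reaches[OF B(1) that(2)] that(3)]] .
  have "v \<in> W" if "(r, v) \<in> (sym_rel G (arcs F))\<^sup>*" for v
    using that
  proof induction
    case base
    then show ?case using branching_arcs(4)[OF B(1)] .
  next
    case (step u v)
    then consider e where "e \<in> arcs F" "u = tail G e" "v = head G e"
      | e where "e \<in> arcs F" "u = head G e" "v = tail G e"
      by (auto simp: sym_rel_def arc_rel_def)
    then show ?case
    proof cases
      case 1
      then show ?thesis using closed step by blast
    next
      case (2 e)
      show ?thesis
      proof (rule ccontr)
        assume "v \<notin> W"
        then have "B \<subseteq> arcs F - {e}" using B branching_arcs(6)[OF B(1)] 2 by auto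
        then have "(head G e, r) \<in> (sym_rel G (arcs F - {e}))\<^sup>*"
          using conn step 2 branching_arcs(4)[OF B(1)] by auto
        moreover have "same_component (pre_digraph.del_arc F e) r (tail F e)"
          using arb 2 by (auto simp: arborescence_def)
        then have "(r, tail G e) \<in> (sym_rel G (arcs F - {e}))\<^sup>*"
        proof -
          have "wf_digraph (pre_digraph.del_arc F e)"
            using wf by (simp add: pre_digraph.del_arc_def wf_digraph_def)
          moreover have "sym_rel (pre_digraph.del_arc F e) = sym_rel G"
            by (auto simp: fun_eq_iff arc_rel_def sym_rel_def F pre_digraph.del_arc_def)
          ultimately show ?thesis
            using \<open>same_component _ _ _\<close> by (simp add: same_component_iff pre_digraph.del_arc_def F)
        qed
        ultimately show False using no_bypass 2 rtrancl_trans by metis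
      qed
    qed
  qed
  moreover have "(r, v) \<in> (sym_rel G (arcs F))\<^sup>*" if "v \<in> verts G" for v
    using arb that r by (auto simp: arborescence_def undirected_tree_def connected_iff[OF wf] F rel)
  ultimately have "verts G \<subseteq> W" by blast
  have "e \<in> B" if "e \<in> arcs F" for e
  proof (rule ccontr)
    assume "e \<notin> B"
    then have "B \<subseteq> arcs F - {e}" using B(2) by blast
    moreover have "e \<in> arcs G" using that F(2) by blast
    then have "head G e \<in> W" "tail G e \<in> W" using \<open>verts G \<subseteq> W\<close> by auto
    ultimately show False using no_bypass[OF that] conn by simp
  qed
  then have "A = B" using A B by auto
  moreover have "W = verts G"
    using branching_verts[OF B(1) r] \<open>verts G \<subseteq> W\<close> by blast
  ultimately show "A \<in> {B. branching G r B (verts G)}"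
    using B(1) by simp
qed

section \<open>Balanced cuts of an Eulerian digraph\<close>

context eulerian_digraph
begin

lemma sum_head_eq_sum_tail:
  fixes p :: "'v \<Rightarrow> real"
  shows "(\<Sum>e\<in>arcs G. p (head G e)) = (\<Sum>e\<in>arcs G. p (tail G e))"
proof -
  have "(\<Sum>e\<in>arcs G. p (head G e)) = (\<Sum>v\<in>verts G. \<Sum>e\<in>in_arcs G v. p (head G e))"
    unfolding in_arcs_def by (intro sum.group[symmetric]) auto
  also have "\<dots> = (\<Sum>v\<in>verts G. real (in_degree G v) * p v)"
    by (intro sum.cong refl) (simp add: in_degree_def)
  also have "\<dots> = (\<Sum>v\<in>verts G. real (out_degree G v) * p v)"
    using balanced by simp
  also have "\<dots> = (\<Sum>v\<in>verts G. \<Sum>e\<in>out_arcs G v. p (tail G e))"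
    by (intro sum.cong refl) (simp add: out_degree_def)
  also have "\<dots> = (\<Sum>e\<in>arcs G. p (tail G e))"
    unfolding out_arcs_def by (intro sum.group) auto
  finally show ?thesis .
qed

lemma crossing_arc:
  assumes "r \<in> W" "r \<in> verts G" "v \<in> verts G" "v \<notin> W"
  shows "\<exists>e\<in>arcs G. tail G e \<in> W \<longleftrightarrow> head G e \<notin> W"
proof (rule ccontr)
  assume none: "\<not> ?thesis"
  have "(r, v) \<in> (sym_rel G (arcs G))\<^sup>*"
    using connected assms unfolding connected_iff[OF wf_digraph] by blast
  then have "v \<in> W"
    by induction (use assms none in \<open>auto simp: sym_rel_def arc_rel_def\<close>)
  then show False using assms by simp
qed

text \<open>
  Some arc crosses \<open>W\<close> by connectedness; if none left it, the balance of the cut would fail.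
\<close>

lemma leaving_arc:
  assumes "r \<in> W" "r \<in> verts G" "v \<in> verts G" "v \<notin> W"
  shows "\<exists>e\<in>arcs G. tail G e \<in> W \<and> head G e \<notin> W"
proof (rule ccontr)
  assume none: "\<not> ?thesis"
  define p :: "'v \<Rightarrow> real" where "p v = (if v \<in> W then 1 else 0)" for v
  have nonneg: "p (head G e) - p (tail G e) \<ge> 0" if "e \<in> arcs G" for e
    using none that by (auto simp: p_def)
  have "(\<Sum>e\<in>arcs G. p (head G e) - p (tail G e)) = 0"
    using sum_head_eq_sum_tail by (simp add: sum_subtractf)
  then have "\<forall>e\<in>arcs G. p (head G e) - p (tail G e) = 0"
    using nonneg by (subst (asm) sum_nonneg_eq_0_iff) auto
  then show False using crossing_arc[OF assms] by (auto simp: p_def split: if_splits)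
qed

lemma arc_into_vertex:
  assumes "arcs G \<noteq> {}" "r \<in> verts G"
  shows "\<exists>e\<in>arcs G. head G e = r"
proof (cases "verts G = {r}")
  case True
  then show ?thesis using assms head_in_verts by fastforce
next
  case False
  then obtain v where "v \<in> verts G" "v \<notin> {r}" using assms by blast
  then obtain e where "e \<in> arcs G" "tail G e = r" using leaving_arc[of r "{r}" v] assms by auto
  then have "e \<in> out_arcs G r" by simp
  then have "out_degree G r \<noteq> 0" unfolding out_degree_def by (metis card_0_eq empty_iff finite_out_arcs)
  then have "in_arcs G r \<noteq> {}" using balanced[OF assms(2)] unfolding in_degree_def by (metis card.empty)
  then show ?thesis by auto
qed

lemma spans_from_arcs: "r \<in> verts G \<Longrightarrow> spans_from G r (arcs G)"
proof -
  assume r: "r \<in> verts G"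
  obtain B W where B: "branching G r B W" "B \<subseteq> arcs G" "\<forall>e\<in>arcs G. tail G e \<in> W \<longrightarrow> head G e \<in> W"
    using branching_maximal[of "arcs G" G r] by auto
  then have "verts G \<subseteq> W" using leaving_arc[of r W] r branching_arcs(4)[OF B(1)] by blast
  then have "spans_from G r B"
    using branching_reaches[OF B(1)] by (auto simp: spans_from_def)
  then show ?thesis using B(2) by (rule spans_from_mono)
qed

end

section \<open>Linear dependences among the columns are potential differences\<close>

definition pot_diff :: "('v, 'e) pre_digraph \<Rightarrow> ('v \<Rightarrow> real) \<Rightarrow> 'e \<Rightarrow> real" where
  "pot_diff G p e = p (head G e) - p (tail G e)"

text \<open>
  The root is part of the locale since the normal forms of lattice points depend on it; the root
  polytope does not.
\<close>

locale oriented_dual = eulerian_digraph G for G :: "('v, 'e) pre_digraph" (structure) +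
  fixes a :: "'e \<Rightarrow> int ^ 'n" and r :: 'v
  assumes tu: "totally_unimodular (arcs G) a"
    and rep: "represents_oriented_dual a G"
    and root: "r \<in> verts G"
begin

definition comb :: "('e \<Rightarrow> real) \<Rightarrow> real ^ 'n" where
  "comb x = (\<Sum>e\<in>arcs G. x e *\<^sub>R real_col a e)"

lemma comb_add: "comb (\<lambda>e. x e + y e) = comb x + comb y"
  by (simp add: comb_def scaleR_add_left sum.distrib)

lemma comb_scale: "comb (\<lambda>e. c * x e) = c *\<^sub>R comb x"
  by (simp add: comb_def scaleR_right.sum)

lemma comb_cong: "(\<And>e. e \<in> arcs G \<Longrightarrow> x e = y e) \<Longrightarrow> comb x = comb y"
  by (simp add: comb_def)

lemma comb_restrict: "C \<subseteq> arcs G \<Longrightarrow> (\<And>e. e \<in> arcs G - C \<Longrightarrow> x e = 0) \<Longrightarrow>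
    comb x = (\<Sum>e\<in>C. x e *\<^sub>R real_col a e)"
  unfolding comb_def by (intro sum.mono_neutral_right) auto

lemma pot_diff_indicator_cut:
  "X \<subseteq> verts G \<Longrightarrow> e \<in> arcs G \<Longrightarrow> pot_diff G (indicator X) e \<noteq> 0 \<longleftrightarrow> e \<in> cut G X"
  by (auto simp: pot_diff_def cut_def arcs_from_to_def indicator_def)

lemma circuit_is_cut:
  assumes "is_circuit (arcs G) a C"
  obtains X where "X \<subseteq> verts G" "elementary_cut G (cut G X)" "C = cut G X"
proof -
  have C: "C \<subseteq> arcs G" "lin_dependent_family a C" using assms by (auto simp: is_circuit_def)
  have fin: "finite C" using C(1) finite_subset finite_arcs by blast
  obtain l f where l: "(\<Sum>e\<in>C. l e *\<^sub>R real_col a e) = 0" "f \<in> C" "l f \<noteq> 0"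
    using C(2) by (auto simp: lin_dependent_family_def)
  have nz: "l e \<noteq> 0" if "e \<in> C" for e
    using circuit_coefficients_nonzero[OF assms fin l that] .
  define P N where "P = {e \<in> C. l e > 0}" and "N = {e \<in> C. l e < 0}"
  have PN: "P \<union> N = C" "P \<inter> N = {}" using nz by (force simp: P_def N_def)+
  have "(P, N) \<in> signed_circuits (arcs G) a"
    unfolding signed_circuits_def using PN assms l(1) by (auto simp: P_def N_def)
  then have "(P, N) \<in> signed_elementary_cuts G"
    using rep by (simp add: represents_oriented_dual_def)
  then obtain X where "X \<subseteq> verts G" "elementary_cut G (cut G X)"
    "P = arcs_from_to G X (verts G - X)" "N = arcs_from_to G (verts G - X) X"
    by (auto simp: signed_elementary_cuts_def)
  then show ?thesis using PN(1) that by (auto simp: cut_def)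
qed

text \<open>
  The signed circuit of the cut has a dependence with the signs of the cut; equal absolute values
  make it a multiple of the potential difference of the indicator function of \<open>X\<close>.
\<close>

lemma comb_elementary_cut:
  assumes "X \<subseteq> verts G" "elementary_cut G (cut G X)"
  shows "comb (pot_diff G (indicator X)) = 0"
proof -
  define P N where "P = arcs_from_to G X (verts G - X)" and "N = arcs_from_to G (verts G - X) X"
  have cut: "cut G X = P \<union> N" by (simp add: cut_def P_def N_def)
  have "(P, N) \<in> signed_circuits (arcs G) a"
    using rep assms unfolding represents_oriented_dual_def signed_elementary_cuts_def P_def N_def by auto
  then obtain l where C: "is_circuit (arcs G) a (P \<union> N)" and disj: "P \<inter> N = {}"
    and l: "\<And>e. e \<in> P \<Longrightarrow> l e > 0" "\<And>e. e \<in> N \<Longrightarrow> l e < 0" "(\<Sum>e\<in>P \<union> N. l e *\<^sub>R real_col a e) = 0"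
    unfolding signed_circuits_def by blast
  have sub: "P \<union> N \<subseteq> arcs G" using C by (simp add: is_circuit_def)
  then have fin: "finite (P \<union> N)" using finite_subset finite_arcs by blast
  obtain f where f: "f \<in> P \<union> N" using assms(2) cut unfolding elementary_cut_def by blast
  have nz: "l e \<noteq> 0" if "e \<in> P \<union> N" for e using l that by force
  have abs: "\<bar>l e\<bar> = \<bar>l f\<bar>" if "e \<in> P \<union> N" for e
    using totally_unimodular_circuit_coefficients[OF tu C fin l(3) nz that f] .
  have "comb (pot_diff G (indicator X)) = (\<Sum>e\<in>P \<union> N. pot_diff G (indicator X) e *\<^sub>R real_col a e)"
    using sub pot_diff_indicator_cut[OF assms(1)] cut by (intro comb_restrict) auto
  also have "\<dots> = (\<Sum>e\<in>P \<union> N. (- 1 / \<bar>l f\<bar>) *\<^sub>R (l e *\<^sub>R real_col a e))"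
  proof (rule sum.cong[OF refl])
    fix e assume e: "e \<in> P \<union> N"
    have "pot_diff G (indicator X) e = (if e \<in> P then -1 else 1)"
      using e disj by (auto simp: pot_diff_def P_def N_def arcs_from_to_def)
    also have "\<dots> = - 1 / \<bar>l f\<bar> * l e"
      using e abs[OF e] l(1)[of e] l(2)[of e] nz[OF f] by (auto simp: field_simps)
    finally show "pot_diff G (indicator X) e *\<^sub>R real_col a e = (- 1 / \<bar>l f\<bar>) *\<^sub>R (l e *\<^sub>R real_col a e)"
      by simp
  qed
  also have "\<dots> = 0" unfolding scaleR_right.sum[symmetric] l(3) by simp
  finally show ?thesis .
qed

lemma elementary_cut_within:
  assumes "X \<subseteq> verts G" "cut G X \<noteq> {}"
  obtains Y where "Y \<subseteq> verts G" "elementary_cut G (cut G Y)" "cut G Y \<subseteq> cut G X"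
proof -
  define K where "K = {C. C \<noteq> {} \<and> C \<subseteq> cut G X \<and> (\<exists>Y\<subseteq>verts G. C = cut G Y)}"
  have "cut G X \<subseteq> arcs G" by (auto simp: cut_def arcs_from_to_def)
  then have "finite (cut G X)" using finite_subset finite_arcs by blast
  then have "finite K" by (simp add: K_def)
  moreover have "cut G X \<in> K" using assms by (auto simp: K_def)
  ultimately obtain C where C: "C \<in> K" and min: "\<And>C'. C' \<in> K \<Longrightarrow> C' \<subseteq> C \<Longrightarrow> C = C'"
    using finite_has_minimal[of K] by auto
  obtain Y where Y: "Y \<subseteq> verts G" "C = cut G Y" using C by (auto simp: K_def)
  have "elementary_cut G (cut G Y)"
    unfolding elementary_cut_def
  proof (intro conjI allI impI notI)
    show False if "cut G Y = {}" using that C Y by (simp add: K_def)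
    show "\<exists>X\<subseteq>verts G. cut G Y = cut G X" using Y by blast
    fix Z assume Z: "Z \<subseteq> verts G" "cut G Z \<noteq> {}" "cut G Z \<subset> cut G Y"
    then have "cut G Z \<in> K" using C Y by (auto simp: K_def)
    then show False using min[of "cut G Z"] Z Y by blast
  qed
  moreover have "cut G Y \<subseteq> cut G X" using C Y by (auto simp: K_def)
  ultimately show ?thesis using that Y by blast
qed

text \<open>
  Both inclusions between the kernel and the potential differences follow by induction on the
  support: a nonzero vector of either kind has an elementary cut in its support, and subtracting a
  multiple of the indicator vector of that cut, which belongs to both spaces, removes an arc from
  the support.
\<close>

lemma support_reduction:
  fixes z w :: "'e \<Rightarrow> real"
  assumes "f \<in> arcs G" "w f \<noteq> 0" "\<And>e. e \<in> arcs G \<Longrightarrow> w e \<noteq> 0 \<Longrightarrow> z e \<noteq> 0"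
  shows "card {e \<in> arcs G. z e - z f / w f * w e \<noteq> 0} < card {e \<in> arcs G. z e \<noteq> 0}"
proof (rule psubset_card_mono)
  have "f \<notin> {e \<in> arcs G. z e - z f / w f * w e \<noteq> 0}" "f \<in> {e \<in> arcs G. z e \<noteq> 0}"
    using assms by auto
  moreover have "z e \<noteq> 0" if "e \<in> arcs G" "z e - z f / w f * w e \<noteq> 0" for e
    using assms(3)[OF that(1)] that(2) by (cases "w e = 0") auto
  ultimately show "{e \<in> arcs G. z e - z f / w f * w e \<noteq> 0} \<subset> {e \<in> arcs G. z e \<noteq> 0}" by blast
qed simp

lemma comb_pot_diff: "comb (pot_diff G p) = 0"
proof (induction "card {e \<in> arcs G. pot_diff G p e \<noteq> 0}" arbitrary: p rule: less_induct)
  case less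
  show ?case
  proof (cases "\<exists>e\<in>arcs G. pot_diff G p e \<noteq> 0")
    case False
    then show ?thesis by (simp add: comb_def)
  next
    case True
    then obtain e where e: "e \<in> arcs G" "p (head G e) \<noteq> p (tail G e)" by (auto simp: pot_diff_def)
    define X where "X = {v \<in> verts G. max (p (head G e)) (p (tail G e)) \<le> p v}"
    have X: "X \<subseteq> verts G" by (auto simp: X_def)
    have "e \<in> cut G X" using e by (auto simp: cut_def arcs_from_to_def X_def max_def)
    then obtain Y where Y: "Y \<subseteq> verts G" "elementary_cut G (cut G Y)" "cut G Y \<subseteq> cut G X"
      using elementary_cut_within[OF X] by blast
    have supp: "pot_diff G p g \<noteq> 0" if "g \<in> cut G X" for g
      using that by (auto simp: cut_def arcs_from_to_def X_def pot_diff_def)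
    let ?w = "pot_diff G (indicator Y)"
    obtain f where "f \<in> cut G Y" using Y(2) by (auto simp: elementary_cut_def)
    then have f: "f \<in> arcs G" "?w f \<noteq> 0"
      using pot_diff_indicator_cut[OF Y(1)] by (auto simp: cut_def arcs_from_to_def)
    define c where "c = pot_diff G p f / ?w f"
    have diff: "pot_diff G (\<lambda>v. p v - c * indicator Y v) = (\<lambda>g. pot_diff G p g - c * ?w g)"
      by (auto simp: fun_eq_iff pot_diff_def algebra_simps)
    have "card {g \<in> arcs G. pot_diff G p g - c * ?w g \<noteq> 0} < card {g \<in> arcs G. pot_diff G p g \<noteq> 0}"
      unfolding c_def using f Y(3) supp pot_diff_indicator_cut[OF Y(1)]
      by (intro support_reduction) auto
    then have "comb (\<lambda>g. pot_diff G p g - c * ?w g) = 0" using less[of "\<lambda>v. p v - c * indicator Y v"] unfolding diff by blast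
    moreover have "comb (pot_diff G p) = comb (\<lambda>g. pot_diff G p g - c * ?w g) + comb (\<lambda>g. c * ?w g)"
      unfolding comb_add[symmetric] by simp
    ultimately show ?thesis using comb_elementary_cut[OF Y(1,2)] by (simp add: comb_scale)
  qed
qed

lemma comb_eq_0_imp_pot_diff:
  assumes "comb z = 0"
  shows "\<exists>p. \<forall>e\<in>arcs G. z e = pot_diff G p e"
  using assms
proof (induction "card {e \<in> arcs G. z e \<noteq> 0}" arbitrary: z rule: less_induct)
  case less
  let ?S = "{e \<in> arcs G. z e \<noteq> 0}"
  show ?case
  proof (cases "?S = {}")
    case True
    then show ?thesis by (intro exI[of _ "\<lambda>_. 0"]) (auto simp: pot_diff_def)
  next
    case False
    have "comb z = (\<Sum>e\<in>?S. z e *\<^sub>R real_col a e)" by (rule comb_restrict) auto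
    then have "(\<Sum>e\<in>?S. z e *\<^sub>R real_col a e) = 0" using less.prems by simp
    then have "lin_dependent_family a ?S"
      using False unfolding lin_dependent_family_def by blast
    then obtain C where C: "C \<subseteq> ?S" "is_circuit (arcs G) a C"
      using lin_dependent_family_contains_circuit[of a ?S "arcs G"] by auto
    then obtain Y where Y: "Y \<subseteq> verts G" "elementary_cut G (cut G Y)" "C = cut G Y"
      using circuit_is_cut by blast
    let ?w = "pot_diff G (indicator Y)"
    obtain f where "f \<in> cut G Y" using Y(2) by (auto simp: elementary_cut_def)
    then have f: "f \<in> arcs G" "?w f \<noteq> 0"
      using pot_diff_indicator_cut[OF Y(1)] by (auto simp: cut_def arcs_from_to_def)
    define c where "c = z f / ?w f"
    have "card {g \<in> arcs G. z g - c * ?w g \<noteq> 0} < card ?S"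
      unfolding c_def using f Y(3) C(1) pot_diff_indicator_cut[OF Y(1)]
      by (intro support_reduction) auto
    moreover have "comb z = comb (\<lambda>g. z g - c * ?w g) + comb (\<lambda>g. c * ?w g)"
      unfolding comb_add[symmetric] by simp
    then have "comb (\<lambda>g. z g - c * ?w g) = 0"
      using less.prems comb_elementary_cut[OF Y(1,2)] by (simp add: comb_scale)
    ultimately obtain p where p: "\<forall>e\<in>arcs G. z e - c * ?w e = pot_diff G p e"
      using less.hyps[of "\<lambda>g. z g - c * ?w g"] by blast
    then have "\<forall>e\<in>arcs G. z e = pot_diff G (\<lambda>v. p v + c * indicator Y v) e"
      by (auto simp: pot_diff_def algebra_simps)
    then show ?thesis by blast
  qed
qed

text \<open>
  A circuit would be an elementary cut, and a cut that avoids a spanning branching is empty.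
\<close>

lemma independent_off_branching:
  assumes "branching G r B (verts G)"
  shows "\<not> lin_dependent_family a (arcs G - B)"
proof
  assume "lin_dependent_family a (arcs G - B)"
  then obtain C where C: "C \<subseteq> arcs G - B" "is_circuit (arcs G) a C"
    using lin_dependent_family_contains_circuit[of a "arcs G - B" "arcs G"] by auto
  then obtain X where X: "X \<subseteq> verts G" "elementary_cut G (cut G X)" "C = cut G X"
    using circuit_is_cut by blast
  have B: "tail G e \<in> X \<longleftrightarrow> head G e \<in> X" if "e \<in> B" for e
  proof -
    have "e \<in> arcs G" "e \<notin> cut G X" using that C X branching_arcs(1)[OF assms] by auto
    then show ?thesis by (auto simp: cut_def arcs_from_to_def)
  qed
  have reach: "v \<in> X \<longleftrightarrow> r \<in> X" if "v \<in> verts G" for v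
  proof -
    have "(r, v) \<in> (arc_rel G B)\<^sup>*" using branching_reaches[OF assms that] .
    then show ?thesis by induction (use B in \<open>auto simp: arc_rel_def\<close>)
  qed
  obtain f where "f \<in> cut G X" using X(2) by (auto simp: elementary_cut_def)
  then show False using reach by (auto simp: cut_def arcs_from_to_def)
qed

end

section \<open>Reduced weights\<close>

lemma (in eulerian_digraph) sum_pot_diff: "(\<Sum>e\<in>arcs G. pot_diff G p e) = 0"
  using sum_head_eq_sum_tail[of p] by (simp add: pot_diff_def sum_subtractf)

text \<open>
  The potential is built as in Dijkstra's algorithm, by induction on the number of vertices that the
  root does not yet reach along arcs of weight 0.
\<close>

lemma (in eulerian_digraph) reduced_weight_exists:
  assumes root: "r \<in> verts G" and "\<And>e. e \<in> arcs G \<Longrightarrow> x e \<ge> 0"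
  shows "\<exists>p. (\<forall>e\<in>arcs G. x e + pot_diff G p e \<ge> 0) \<and>
    spans_from G r {e \<in> arcs G. x e + pot_diff G p e = 0}"
  using assms(2)
proof (induction "card (verts G - {v. (r, v) \<in> (arc_rel G {e \<in> arcs G. x e = 0})\<^sup>*})"
    arbitrary: x rule: less_induct)
  case less
  define Z where "Z x = {e \<in> arcs G. x e = 0}" for x :: "'e \<Rightarrow> real"
  define R where "R x = {v. (r, v) \<in> (arc_rel G (Z x))\<^sup>*}" for x
  show ?case
  proof (cases "verts G \<subseteq> R x")
    case True
    then have "spans_from G r (Z x)" by (auto simp: spans_from_def R_def)
    then show ?thesis
      using less.prems by (intro exI[of _ "\<lambda>_. 0"]) (auto simp: pot_diff_def Z_def)
  next
    case False
    have zero_step: "head G e \<in> R y" if "e \<in> Z y" "tail G e \<in> R y" for e y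
      using that unfolding R_def by (auto intro: rtrancl_into_rtrancl arc_relI)
    have rR: "r \<in> R y" for y by (simp add: R_def)
    define L where "L = {e \<in> arcs G. tail G e \<in> R x \<and> head G e \<notin> R x}"
    have L: "finite L" "L \<noteq> {}"
      using leaving_arc[OF rR[of x] root] False by (auto simp: L_def)
    have pos: "x e > 0" if "e \<in> L" for e
      using that less.prems[of e] zero_step[of e x] by (force simp: L_def Z_def)
    define \<epsilon> where "\<epsilon> = Min (x ` L)"
    have \<epsilon>: "\<epsilon> > 0" "\<And>e. e \<in> L \<Longrightarrow> \<epsilon> \<le> x e" using L pos by (auto simp: \<epsilon>_def)
    have "\<epsilon> \<in> x ` L" unfolding \<epsilon>_def using L by (intro Min_in) auto
    then obtain f where f: "f \<in> L" "x f = \<epsilon>" by blast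
    \<comment> \<open>Lowering the potential outside \<open>R x\<close> shortens the leaving arcs until one of them
      has weight 0; weights inside \<open>R x\<close> do not change.\<close>
    define p where "p v = (if v \<in> R x then 0 else - \<epsilon>)" for v
    define y where "y e = x e + pot_diff G p e" for e
    have y: "y e = (if tail G e \<in> R x \<and> head G e \<notin> R x then x e - \<epsilon>
        else if tail G e \<notin> R x \<and> head G e \<in> R x then x e + \<epsilon> else x e)" for e
      by (simp add: y_def pot_diff_def p_def)
    have nonneg: "y e \<ge> 0" if "e \<in> arcs G" for e
      using less.prems[OF that] \<epsilon> that by (auto simp: y L_def)
    have sub: "R x \<subseteq> R y"
    proof
      fix v assume "v \<in> R x"
      then have "(r, v) \<in> (arc_rel G (Z x))\<^sup>*" by (simp add: R_def)
      then have "v \<in> R x \<and> v \<in> R y"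
      proof induction
        case base
        show ?case using rR by blast
      next
        case (step u v)
        then obtain e where e: "e \<in> Z x" "u = tail G e" "v = head G e" by (auto simp: arc_rel_def)
        then have "head G e \<in> R x" using step zero_step by blast
        moreover from this have "e \<in> Z y" using e step by (simp add: Z_def y)
        ultimately show ?case
          using e step zero_step by blast
      qed
      then show "v \<in> R y" by blast
    qed
    have "f \<in> Z y" using f by (auto simp: Z_def y L_def)
    then have "head G f \<in> R y" using zero_step sub f by (auto simp: L_def)
    moreover have "head G f \<in> verts G - R x" using f by (auto simp: L_def)
    ultimately have "verts G - R y \<subset> verts G - R x" using sub by blast
    then have "card (verts G - R y) < card (verts G - R x)" by (simp add: psubset_card_mono)
    then obtain q where q: "\<forall>e\<in>arcs G. y e + pot_diff G q e \<ge> 0"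
      "spans_from G r {e \<in> arcs G. y e + pot_diff G q e = 0}"
      using less.hyps[of y] nonneg unfolding R_def Z_def by blast
    have "y e + pot_diff G q e = x e + pot_diff G (\<lambda>v. p v + q v) e" for e
      by (simp add: y_def pot_diff_def)
    then show ?thesis using q by auto
  qed
qed

text \<open>
  Along a zero arc of \<open>x\<close> nonnegativity of \<open>y\<close> makes \<open>p\<close> weakly increase, and along a zero arc of
  \<open>y\<close> nonnegativity of \<open>x\<close> makes it weakly decrease.  Both kinds of arcs reach every vertex from the
  root, so \<open>p\<close> is constant.
\<close>

lemma reduced_weight_unique:
  assumes x: "\<And>e. e \<in> arcs G \<Longrightarrow> x e \<ge> 0" "spans_from G r {e \<in> arcs G. x e = 0}"
    and y: "\<And>e. e \<in> arcs G \<Longrightarrow> y e \<ge> 0" "spans_from G r {e \<in> arcs G. y e = 0}"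
    and p: "\<And>e. e \<in> arcs G \<Longrightarrow> y e = x e + pot_diff G p e"
    and wf: "wf_digraph G" and e: "e \<in> arcs G"
  shows "x e = y e"
proof -
  have "p r \<le> p v" if "(r, v) \<in> (arc_rel G {e \<in> arcs G. x e = 0})\<^sup>*" for v
    using that
  proof induction
    case (step u v)
    then obtain e where "e \<in> arcs G" "x e = 0" "u = tail G e" "v = head G e" by (auto simp: arc_rel_def)
    then show ?case using step p[of e] y(1)[of e] by (simp add: pot_diff_def)
  qed simp
  moreover have "p v \<le> p r" if "(r, v) \<in> (arc_rel G {e \<in> arcs G. y e = 0})\<^sup>*" for v
    using that
  proof induction
    case (step u v)
    then obtain e where "e \<in> arcs G" "y e = 0" "u = tail G e" "v = head G e" by (auto simp: arc_rel_def)
    then show ?case using step p[of e] x(1)[of e] by (simp add: pot_diff_def)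
  qed simp
  ultimately have "p v = p r" if "v \<in> verts G" for v
    using x(2) y(2) that by (meson antisym spans_from_def)
  then have "pot_diff G p e = 0"
    using wf e by (simp add: pot_diff_def wf_digraph.head_in_verts wf_digraph.tail_in_verts)
  then show ?thesis using p[OF e] by simp
qed

lemma spans_from_remove_arc_into_root:
  assumes "head G f = r"
  shows "spans_from G r (Z - {f}) \<longleftrightarrow> spans_from G r Z"
proof
  assume span: "spans_from G r Z"
  have "(r, v) \<in> (arc_rel G (Z - {f}))\<^sup>*" if "(r, v) \<in> (arc_rel G Z)\<^sup>*" for v
    using that
  proof induction
    case (step u v)
    then obtain e where e: "e \<in> Z" "u = tail G e" "v = head G e" by (auto simp: arc_rel_def)
    show ?case
    proof (cases "e = f")
      case True
      then show ?thesis using assms e by simp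
    next
      case False
      then have "(u, v) \<in> arc_rel G (Z - {f})" using e by (auto intro: arc_relI)
      then show ?thesis using step by (meson rtrancl_into_rtrancl)
    qed
  qed simp
  then show "spans_from G r (Z - {f})" using span by (auto simp: spans_from_def)
qed (rule spans_from_mono, auto)

section \<open>Lattice points and dimension of the root polytope\<close>

context oriented_dual
begin

lemma root_polytope_iff_comb:
  "y \<in> root_polytope (arcs G) a \<longleftrightarrow>
    (\<exists>u. (\<forall>e\<in>arcs G. 0 \<le> u e) \<and> sum u (arcs G) = 1 \<and> comb u = y)"
proof
  assume "y \<in> root_polytope (arcs G) a"
  then obtain v where v: "\<forall>z\<in>real_col a ` arcs G. 0 \<le> v z" "sum v (real_col a ` arcs G) = 1"
    "(\<Sum>z\<in>real_col a ` arcs G. v z *\<^sub>R z) = y"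
    by (auto simp: root_polytope_def convex_hull_finite)
  \<comment> \<open>Several arcs may have the same column; one of them receives the weight of that point.\<close>
  define c where "c z = (SOME e. e \<in> arcs G \<and> real_col a e = z)" for z
  have c: "c z \<in> arcs G" "real_col a (c z) = z" if "z \<in> real_col a ` arcs G" for z
    using someI_ex[of "\<lambda>e. e \<in> arcs G \<and> real_col a e = z"] that unfolding c_def by auto
  define D where "D = c ` real_col a ` arcs G"
  have D: "D \<subseteq> arcs G" using c by (auto simp: D_def)
  have inj: "inj_on c (real_col a ` arcs G)" using c(2) by (metis inj_onI)
  define u where "u e = (if e \<in> D then v (real_col a e) else 0)" for e
  have "sum u (arcs G) = sum u D"
    using D by (intro sum.mono_neutral_right) (auto simp: u_def)
  also have "\<dots> = sum v (real_col a ` arcs G)"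
    unfolding D_def using c(2) by (subst sum.reindex[OF inj]) (auto simp: u_def D_def intro!: sum.cong)
  finally have "sum u (arcs G) = 1" using v by simp
  moreover have "comb u = (\<Sum>e\<in>D. u e *\<^sub>R real_col a e)"
    using D by (intro comb_restrict) (auto simp: u_def)
  then have "comb u = (\<Sum>z\<in>real_col a ` arcs G. v z *\<^sub>R z)"
    unfolding D_def using c(2) by (subst (asm) sum.reindex[OF inj]) (auto simp: u_def D_def intro!: sum.cong)
  ultimately show "\<exists>u. (\<forall>e\<in>arcs G. 0 \<le> u e) \<and> sum u (arcs G) = 1 \<and> comb u = y"
    using v by (intro exI[of _ u]) (auto simp: u_def)
next
  assume "\<exists>u. (\<forall>e\<in>arcs G. 0 \<le> u e) \<and> sum u (arcs G) = 1 \<and> comb u = y"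
  then obtain u where u: "\<forall>e\<in>arcs G. 0 \<le> u e" "sum u (arcs G) = 1" "comb u = y" by blast
  have "(\<Sum>e\<in>arcs G. u e *\<^sub>R real_col a e) \<in> convex hull (real_col a ` arcs G)"
    using u by (intro convex_sum convex_convex_hull) (auto intro: hull_inc)
  then show "y \<in> root_polytope (arcs G) a"
    using u(3) by (simp add: root_polytope_def comb_def)
qed

text \<open>
  The support of a reduced weight avoids a spanning branching, so its columns are independent.
\<close>

lemma comb_integral_imp_integral:
  assumes "spans_from G r {e \<in> arcs G. x e = 0}" "\<And>i. comb x $ i \<in> \<int>" "e \<in> arcs G"
  shows "x e \<in> \<int>"
proof (cases "x e = 0")
  case False
  obtain B where B: "B \<subseteq> {e \<in> arcs G. x e = 0}" "branching G r B (verts G)"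
    using assms(1) spans_from_iff_branching[OF root, of "{e \<in> arcs G. x e = 0}"] by auto
  have "comb x = (\<Sum>e\<in>arcs G - B. x e *\<^sub>R real_col a e)"
    using B(1) by (intro comb_restrict) auto
  moreover have "e \<in> arcs G - B" using B(1) False assms(3) by auto
  ultimately show ?thesis
    using totally_unimodular_integral_coefficients[OF tu _ _ independent_off_branching[OF B(2)], of x e]
      assms(2) by simp
qed simp

text \<open>
  Functions on all of \<open>'e\<close> have to be 0 off the arcs in order to be determined by their values on
  arcs.
\<close>

definition reduced_weights :: "nat \<Rightarrow> ('e \<Rightarrow> nat) set" where
  "reduced_weights t = {x. (\<forall>e. e \<notin> arcs G \<longrightarrow> x e = 0) \<and> sum x (arcs G) = t \<and>
     spans_from G r {e \<in> arcs G. x e = 0}}"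

text \<open>
  Two reduced weights over the same point differ by a potential difference, so uniqueness makes the
  map injective.  For surjectivity, a lattice point is written as a nonnegative combination of sum
  \<open>t\<close>; reducing it keeps the sum because the digraph is balanced, and makes it integral.
\<close>

lemma ehrhart_eq_card_reduced_weights:
  assumes "arcs G \<noteq> {}"
  shows "ehrhart (root_polytope (arcs G) a) t = card (reduced_weights t)"
proof -
  let ?Q = "root_polytope (arcs G) a"
  let ?f = "\<lambda>x :: 'e \<Rightarrow> nat. comb (\<lambda>e. real (x e))"
  have inj: "inj_on ?f (reduced_weights t)"
  proof (rule inj_onI)
    fix x y assume x: "x \<in> reduced_weights t" and y: "y \<in> reduced_weights t" and eq: "?f x = ?f y"
    have "comb (\<lambda>e. real (y e) + (-1) * real (x e)) = ?f y + (-1) *\<^sub>R ?f x"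
      by (simp only: comb_add comb_scale)
    then obtain p where "\<forall>e\<in>arcs G. real (y e) + (-1) * real (x e) = pot_diff G p e"
      using comb_eq_0_imp_pot_diff eq by fastforce
    then have p: "real (y e) = real (x e) + pot_diff G p e" if "e \<in> arcs G" for e
      using that by (simp add: algebra_simps)
    have "real (x e) = real (y e)" if "e \<in> arcs G" for e
      using x y that
      by (intro reduced_weight_unique[where p = p and r = r, OF _ _ _ _ p wf_digraph])
         (auto simp: reduced_weights_def)
    then have "x e = y e" for e
      using x y by (cases "e \<in> arcs G") (auto simp: reduced_weights_def)
    then show "x = y" by blast
  qed
  have "?f ` reduced_weights t = (\<lambda>x. real t *\<^sub>R x) ` ?Q \<inter> {x. \<forall>i. x $ i \<in> \<int>}"
  proof (intro equalityI subsetI)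
    fix z assume "z \<in> ?f ` reduced_weights t"
    then obtain x where x: "x \<in> reduced_weights t" "z = ?f x" by blast
    have sum: "(\<Sum>e\<in>arcs G. real (x e)) = real t"
      using x(1) by (simp add: reduced_weights_def flip: of_nat_sum)
    have "z $ i \<in> \<int>" for i
      unfolding x(2) comb_def sum_component
      by (intro Ints_sum) (simp add: real_col_def)
    moreover have "z \<in> (\<lambda>x. real t *\<^sub>R x) ` ?Q"
    proof (cases "t = 0")
      case True
      then have "z = 0" using x sum by (simp add: reduced_weights_def comb_def)
      moreover have "?Q \<noteq> {}" using assms by (simp add: root_polytope_def)
      ultimately show ?thesis using True by auto
    next
      case False
      have "comb (\<lambda>e. (1 / real t) * real (x e)) \<in> ?Q"
        unfolding root_polytope_iff_comb using sum False
        by (intro exI[of _ "\<lambda>e. (1 / real t) * real (x e)"]) (simp flip: sum_divide_distrib)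
      moreover have "z = real t *\<^sub>R comb (\<lambda>e. (1 / real t) * real (x e))"
        using False unfolding comb_scale x(2) by simp
      ultimately show ?thesis by blast
    qed
    ultimately show "z \<in> (\<lambda>x. real t *\<^sub>R x) ` ?Q \<inter> {x. \<forall>i. x $ i \<in> \<int>}" by blast
  next
    fix z assume z: "z \<in> (\<lambda>x. real t *\<^sub>R x) ` ?Q \<inter> {x. \<forall>i. x $ i \<in> \<int>}"
    then obtain u where u: "\<forall>e\<in>arcs G. 0 \<le> u e" "sum u (arcs G) = 1" "z = real t *\<^sub>R comb u"
      unfolding root_polytope_iff_comb by (auto simp: root_polytope_iff_comb)
    obtain p where p: "\<forall>e\<in>arcs G. real t * u e + pot_diff G p e \<ge> 0"
      "spans_from G r {e \<in> arcs G. real t * u e + pot_diff G p e = 0}"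
      using reduced_weight_exists[OF root, of "\<lambda>e. real t * u e"] u(1) by auto
    define y where "y e = real t * u e + pot_diff G p e" for e
    have comb_y: "comb y = z"
      unfolding y_def comb_add comb_scale comb_pot_diff u(3) by simp
    have "y e \<in> \<int>" if "e \<in> arcs G" for e
      using comb_integral_imp_integral[of y e] p(2) comb_y z that by (auto simp: y_def)
    then have nat: "real (nat \<lfloor>y e\<rfloor>) = y e" if "e \<in> arcs G" for e
      using p(1) that by (auto simp: y_def)
    define x where "x e = (if e \<in> arcs G then nat \<lfloor>y e\<rfloor> else 0)" for e
    have xy: "real (x e) = y e" if "e \<in> arcs G" for e using nat that by (simp add: x_def)
    have "real (sum x (arcs G)) = sum y (arcs G)" using xy by simp
    also have "\<dots> = real t"
      using u(2) sum_pot_diff[of p] by (simp add: y_def sum.distrib flip: sum_distrib_left)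
    finally have "sum x (arcs G) = t" by linarith
    moreover have "{e \<in> arcs G. x e = 0} = {e \<in> arcs G. y e = 0}"
      using xy by (metis of_nat_eq_0_iff)
    ultimately have "x \<in> reduced_weights t"
      using p(2) by (simp add: reduced_weights_def x_def y_def)
    moreover have "z = ?f x" unfolding comb_y[symmetric] by (rule comb_cong) (simp add: xy)
    ultimately show "z \<in> ?f ` reduced_weights t" by blast
  qed
  then show ?thesis unfolding ehrhart_def using card_image[OF inj] by metis
qed

text \<open>
  The columns off a spanning branching form an affine basis.  They are independent, and any column is
  an affine combination of them: a suitable potential difference clears the coefficients on the
  branching and keeps the coordinate sum 1.
\<close>

lemma aff_dim_root_polytope:
  assumes B: "branching G r B (verts G)"
  shows "aff_dim (root_polytope (arcs G) a) = int (card (arcs G - B)) - 1"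
proof -
  let ?D = "arcs G - B"
  let ?c = "real_col a"
  have indep: "\<not> lin_dependent_family a ?D" using independent_off_branching[OF B] .
  have inj: "inj_on ?c ?D"
  proof (rule inj_onI, rule ccontr)
    fix e f assume ef: "e \<in> ?D" "f \<in> ?D" "?c e = ?c f" "e \<noteq> f"
    define l :: "'e \<Rightarrow> real" where "l g = (if g = e then 1 else if g = f then -1 else 0)" for g
    have "(\<Sum>g\<in>?D. l g *\<^sub>R ?c g) = (\<Sum>g\<in>{e, f}. l g *\<^sub>R ?c g)"
      using ef by (intro sum.mono_neutral_right) (auto simp: l_def)
    also have "\<dots> = 0" using ef by (simp add: l_def)
    finally have "(\<Sum>g\<in>?D. l g *\<^sub>R ?c g) = 0" .
    moreover have "\<exists>g\<in>?D. l g \<noteq> 0" using ef by (intro bexI[of _ e]) (auto simp: l_def)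
    ultimately show False using indep unfolding lin_dependent_family_def by blast
  qed
  have "independent (?c ` ?D)"
  proof
    assume "dependent (?c ` ?D)"
    then obtain u where u: "\<exists>v\<in>?c ` ?D. u v \<noteq> 0" "(\<Sum>v\<in>?c ` ?D. u v *\<^sub>R v) = 0"
      using dependent_finite[of "?c ` ?D"] by auto
    have "(\<Sum>e\<in>?D. u (?c e) *\<^sub>R ?c e) = 0" using u(2) by (simp add: sum.reindex[OF inj])
    then show False using indep u(1) unfolding lin_dependent_family_def by fastforce
  qed
  then have aff: "\<not> affine_dependent (?c ` ?D)" using affine_dependent_imp_dependent by blast
  have "?c e \<in> affine hull (?c ` ?D)" if e: "e \<in> arcs G" for e
  proof -
    define x :: "'e \<Rightarrow> real" where "x f = (if f = e then 1 else 0)" for f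
    obtain p where p: "\<forall>f\<in>B. p (head G f) - p (tail G f) = - x f"
      using branching_potential[OF B, of "\<lambda>f. - x f"] by blast
    define y where "y f = x f + pot_diff G p f" for f
    have y0: "y f = 0" if "f \<in> B" for f using p that by (simp add: y_def pot_diff_def)
    have "comb y = comb x" unfolding y_def comb_add comb_pot_diff by simp
    also have "comb x = (\<Sum>f\<in>{e}. x f *\<^sub>R ?c f)" using e by (intro comb_restrict) (auto simp: x_def)
    finally have "comb y = ?c e" by (simp add: x_def)
    moreover have "comb y = (\<Sum>f\<in>?D. y f *\<^sub>R ?c f)" using y0 by (intro comb_restrict) auto
    ultimately have c: "(\<Sum>f\<in>?D. y f *\<^sub>R ?c f) = ?c e" by simp
    have "sum y (arcs G) = sum x (arcs G)" by (simp add: y_def sum.distrib sum_pot_diff)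
    also have "\<dots> = 1" using e by (simp add: x_def)
    finally have "sum y (arcs G) = 1" .
    moreover have "sum y (arcs G) = sum y ?D" using y0 by (intro sum.mono_neutral_right) auto
    ultimately have "sum y ?D = 1" by simp
    then show ?thesis
      using c by (simp add: affine_hull_finite sum.reindex[OF inj])
         (rule exI[of _ "\<lambda>v. y (the_inv_into ?D ?c v)"], simp add: the_inv_into_f_f[OF inj])
  qed
  then have "?c ` arcs G \<subseteq> affine hull (?c ` ?D)" by blast
  then have "affine hull (?c ` arcs G) = affine hull (?c ` ?D)"
    by (intro equalityI hull_minimal hull_mono) (auto simp: affine_affine_hull)
  then have "aff_dim (?c ` arcs G) = aff_dim (?c ` ?D)" by (metis aff_dim_affine_hull)
  then show ?thesis
    using aff_dim_affine_independent[OF aff] card_image[OF inj]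
    by (simp add: root_polytope_def aff_dim_convex_hull)
qed

end

section \<open>The dual complex is a cone\<close>

context oriented_dual
begin

text \<open>
  For an arc \<open>c\<close> that ends in the root these are the faces of the base of the cone with apex \<open>c\<close>.
\<close>

definition base_faces :: "'e \<Rightarrow> 'e set set" where
  "base_faces c = {T. T \<subseteq> arcs G - {c} \<and> spans_from G r (arcs G - T)}"

lemma finite_base_faces: "finite (base_faces c)"
  by (simp add: base_faces_def)

lemma finite_base_face: "T \<in> base_faces c \<Longrightarrow> finite T"
  by (auto simp: base_faces_def intro: finite_subset)

lemma card_off_branching:
  assumes "branching G r B (verts G)"
  shows "card (arcs G - B) + card (verts G) = card (arcs G) + 1"
  using branching_arcs(1,2,5)[OF assms] card_mono[of "arcs G" B] by (simp add: card_Diff_subset)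

lemma dual_complex_eq:
  "dual_complex (arcs G) (branching_greedoid_bases G r) = {S. S \<subseteq> arcs G \<and> spans_from G r (arcs G - S)}"
  unfolding dual_complex_def branching_greedoid_bases_eq[OF root]
  using spans_from_iff_branching[OF root] by auto

lemma card_face_le:
  assumes "S \<subseteq> arcs G" "spans_from G r (arcs G - S)"
  shows "card S + card (verts G) \<le> card (arcs G) + 1"
proof -
  obtain B where B: "B \<subseteq> arcs G - S" "branching G r B (verts G)"
    using assms spans_from_iff_branching[OF root, of "arcs G - S"] by auto
  then have "card S \<le> card (arcs G - B)" using assms(1) by (intro card_mono) auto
  then show ?thesis using card_off_branching[OF B(2)] by simp
qed

lemma complex_dim_dual_complex:
  "complex_dim (dual_complex (arcs G) (branching_greedoid_bases G r)) = int (card (arcs G)) - int (card (verts G))"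
  unfolding complex_dim_def dual_complex_eq
proof (rule Max_eqI)
  show "finite (simplex_dim ` {S. S \<subseteq> arcs G \<and> spans_from G r (arcs G - S)})" by simp
  show "d \<le> int (card (arcs G)) - int (card (verts G))"
    if d: "d \<in> simplex_dim ` {S. S \<subseteq> arcs G \<and> spans_from G r (arcs G - S)}" for d
  proof -
    obtain S where "S \<subseteq> arcs G" "spans_from G r (arcs G - S)" "d = simplex_dim S"
      using d by blast
    then show ?thesis using card_face_le[of S] by (simp add: simplex_dim_def)
  qed
  obtain B where B: "B \<subseteq> arcs G" "branching G r B (verts G)"
    using spans_from_iff_branching[OF root order_refl, THEN iffD1, OF spans_from_arcs[OF root]] by blast
  have "arcs G - (arcs G - B) = B" using B(1) by blast
  moreover have "spans_from G r B"
    using spans_from_iff_branching[OF root B(1)] B(2) by blast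
  ultimately have "spans_from G r (arcs G - (arcs G - B))" by simp
  moreover have "simplex_dim (arcs G - B) = int (card (arcs G)) - int (card (verts G))"
    using card_off_branching[OF B(2)] by (simp add: simplex_dim_def)
  ultimately show "int (card (arcs G)) - int (card (verts G)) \<in>
      simplex_dim ` {S. S \<subseteq> arcs G \<and> spans_from G r (arcs G - S)}"
    by (metis (mono_tags, lifting) Diff_subset image_eqI mem_Collect_eq)
qed

context
  fixes c :: 'e
  assumes c: "c \<in> arcs G" "head G c = r"
begin

lemma faces_eq_cone:
  "{S. S \<subseteq> arcs G \<and> spans_from G r (arcs G - S)} = base_faces c \<union> insert c ` base_faces c"
proof -
  have cone: "spans_from G r (arcs G - insert c S) \<longleftrightarrow> spans_from G r (arcs G - S)" for S
    using spans_from_remove_arc_into_root[of G c r "arcs G - S"] c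
    by (simp add: Diff_insert[symmetric])
  show ?thesis
  proof (intro equalityI subsetI)
    fix S assume S: "S \<in> {S. S \<subseteq> arcs G \<and> spans_from G r (arcs G - S)}"
    show "S \<in> base_faces c \<union> insert c ` base_faces c"
    proof (cases "c \<in> S")
      case True
      then have "insert c (S - {c}) = S" by blast
      then have "S - {c} \<in> base_faces c" using S cone[of "S - {c}"] by (auto simp: base_faces_def)
      then show ?thesis using \<open>insert c (S - {c}) = S\<close> by (metis UnI2 image_eqI)
    qed (use S in \<open>auto simp: base_faces_def\<close>)
  next
    fix S assume "S \<in> base_faces c \<union> insert c ` base_faces c"
    then show "S \<in> {S. S \<subseteq> arcs G \<and> spans_from G r (arcs G - S)}"
      using c cone by (auto simp: base_faces_def)
  qed
qed

lemma card_base_face_le: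
  assumes "T \<in> base_faces c"
  shows "card T + card (verts G) \<le> card (arcs G)"
proof -
  have "insert c T \<in> {S. S \<subseteq> arcs G \<and> spans_from G r (arcs G - S)}"
    unfolding faces_eq_cone using assms by blast
  then have "card (insert c T) + card (verts G) \<le> card (arcs G) + 1" using card_face_le by blast
  moreover have "c \<notin> T" using assms by (auto simp: base_faces_def)
  ultimately show ?thesis using finite_base_face[OF assms] by simp
qed

lemma card_verts_le: "card (verts G) \<le> card (arcs G)"
  using card_base_face_le[of "{}"] spans_from_arcs[OF root] by (simp add: base_faces_def)

text \<open>
  A face \<open>T\<close> of the base and the face \<open>insert c T\<close> contribute \<open>(t - 1)\<^bsup>d - |T| + 1\<^esup>\<close> and
  \<open>(t - 1)\<^bsup>d - |T|\<^esup>\<close>.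
\<close>

lemma poly_greedoid_polynomial:
  "poly (greedoid_polynomial G r) t =
    (\<Sum>T\<in>base_faces c. t * (t - 1) ^ (card (arcs G) - card (verts G) - card T))"
proof -
  define d where "d = card (arcs G) - card (verts G)"
  let ?K = "dual_complex (arcs G) (branching_greedoid_bases G r)"
  have K: "?K = base_faces c \<union> insert c ` base_faces c" unfolding dual_complex_eq faces_eq_cone ..
  have dim: "complex_dim ?K = int d"
    using complex_dim_dual_complex card_verts_le by (simp add: d_def)
  have notin: "c \<notin> T" if "T \<in> base_faces c" for T using that by (auto simp: base_faces_def)
  have "inj_on (insert c) (base_faces c)"
    using notin by (metis Diff_insert_absorb inj_onI)
  note reindex = sum.reindex[OF this]
  have "poly (greedoid_polynomial G r) t = (\<Sum>S\<in>?K. (t - 1) ^ nat (int d - simplex_dim S))"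
    by (simp add: greedoid_polynomial_def h_polynomial_def f_polynomial_def poly_pcompose poly_sum
        poly_monom dim)
  also have "\<dots> = (\<Sum>S\<in>base_faces c. (t - 1) ^ nat (int d - simplex_dim S))
      + (\<Sum>S\<in>insert c ` base_faces c. (t - 1) ^ nat (int d - simplex_dim S))"
    unfolding K using finite_base_faces notin by (intro sum.union_disjoint) auto
  also have "\<dots> = (\<Sum>T\<in>base_faces c. (t - 1) ^ nat (int d - simplex_dim T)
      + (t - 1) ^ nat (int d - simplex_dim (insert c T)))"
    unfolding reindex sum.distrib by simp
  also have "\<dots> = (\<Sum>T\<in>base_faces c. t * (t - 1) ^ (d - card T))"
  proof (rule sum.cong[OF refl])
    fix T assume T: "T \<in> base_faces c"
    have le: "card T \<le> d" using card_base_face_le[OF T] by (simp add: d_def)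
    have "nat (int d - simplex_dim T) = Suc (d - card T)"
      using le by (simp add: simplex_dim_def)
    moreover have "nat (int d - simplex_dim (insert c T)) = d - card T"
      using le notin[OF T] finite_base_face[OF T] by (simp add: simplex_dim_def)
    ultimately show "(t - 1) ^ nat (int d - simplex_dim T) + (t - 1) ^ nat (int d - simplex_dim (insert c T))
        = t * (t - 1) ^ (d - card T)"
      by (simp add: algebra_simps)
  qed
  finally show ?thesis by (simp add: d_def)
qed

text \<open>
  Reduced weights are grouped by their support without \<open>c\<close>; the value at \<open>c\<close> is unrestricted, which
  is the slack part of the compositions.
\<close>

lemma card_reduced_weights: "card (reduced_weights t) = (\<Sum>T\<in>base_faces c. t choose card T)"
proof -
  define A where "A T = {x :: 'e \<Rightarrow> nat. (\<forall>f\<in>T. 0 < x f) \<and> (\<forall>f. f \<notin> insert c T \<longrightarrow> x f = 0) \<and>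
      sum x (insert c T) = t}" for T
  have A: "finite (A T) \<and> card (A T) = t choose card T" if "T \<in> base_faces c" for T
  proof -
    have "c \<notin> T" using that by (auto simp: base_faces_def)
    then show ?thesis
      unfolding A_def by (rule card_positive_compositions[OF finite_base_face[OF that]])
  qed
  have "x \<in> reduced_weights t \<longleftrightarrow> x \<in> (\<Union>T\<in>base_faces c. A T)" for x
  proof
    assume x: "x \<in> reduced_weights t"
    define T where "T = {e \<in> arcs G - {c}. 0 < x e}"
    have "spans_from G r (arcs G - T)"
    proof (rule spans_from_mono)
      show "spans_from G r {e \<in> arcs G. x e = 0}" using x by (simp add: reduced_weights_def)
    qed (auto simp: T_def)
    then have "T \<in> base_faces c" by (auto simp: base_faces_def T_def)
    moreover have "sum x (arcs G) = sum x (insert c T)"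
      using c by (intro sum.mono_neutral_right) (auto simp: T_def)
    then have "x \<in> A T" using x by (auto simp: A_def T_def reduced_weights_def)
    ultimately show "x \<in> (\<Union>T\<in>base_faces c. A T)" by blast
  next
    assume "x \<in> (\<Union>T\<in>base_faces c. A T)"
    then obtain T where T: "T \<in> base_faces c" "x \<in> A T" by blast
    then have sub: "insert c T \<subseteq> arcs G" using c by (auto simp: base_faces_def)
    have "sum x (arcs G) = sum x (insert c T)"
      using sub T(2) by (intro sum.mono_neutral_right) (auto simp: A_def)
    moreover have "insert c T \<in> {S. S \<subseteq> arcs G \<and> spans_from G r (arcs G - S)}"
      unfolding faces_eq_cone using T(1) by blast
    then have "spans_from G r (arcs G - insert c T)" by simp
    then have "spans_from G r {e \<in> arcs G. x e = 0}"
      by (rule spans_from_mono) (use T(2) in \<open>auto simp: A_def\<close>)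
    ultimately show "x \<in> reduced_weights t"
      using T(2) sub by (auto simp: reduced_weights_def A_def)
  qed
  then have "reduced_weights t = (\<Union>T\<in>base_faces c. A T)" by blast
  then have "card (reduced_weights t) = card (\<Union>T\<in>base_faces c. A T)" by simp
  also have "\<dots> = (\<Sum>T\<in>base_faces c. card (A T))"
  proof (rule card_UN_disjoint[OF finite_base_faces])
    have support: "T = {f. 0 < x f} - {c}" if "T \<in> base_faces c" "x \<in> A T" for T x
      using that by (auto simp: A_def base_faces_def)
    show "\<forall>T\<in>base_faces c. \<forall>T'\<in>base_faces c. T \<noteq> T' \<longrightarrow> A T \<inter> A T' = {}"
      using support by (metis disjoint_iff)
  qed (use A in blast)
  also have "\<dots> = (\<Sum>T\<in>base_faces c. t choose card T)" using A by simp
  finally show ?thesis .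
qed

lemma h_star_root_polytope:
  "h_star (root_polytope (arcs G) a) =
    (\<Sum>T\<in>base_faces c. monom 1 (card T) * [:1, -1:] ^ (card (arcs G) - card (verts G) - card T))"
proof -
  define d where "d = card (arcs G) - card (verts G)"
  let ?Q = "root_polytope (arcs G) a"
  let ?h = "\<Sum>T\<in>base_faces c. monom 1 (card T) * [:1, -1:] ^ (d - card T) :: real poly"
  have arcs: "arcs G \<noteq> {}" using c by blast
  then have "?Q \<noteq> {}" by (simp add: root_polytope_def)
  obtain B where B: "branching G r B (verts G)"
    using spans_from_iff_branching[OF root order_refl, THEN iffD1, OF spans_from_arcs[OF root]] by blast
  have dim: "nat (aff_dim ?Q) = d"
    using aff_dim_root_polytope[OF B] card_off_branching[OF B] card_verts_le by (simp add: d_def)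
  have le: "card T \<le> d" if "T \<in> base_faces c" for T
    using card_base_face_le[OF that] by (simp add: d_def)
  have deg: "degree ?h \<le> d"
    using le by (intro degree_sum_le finite_base_faces degree_face_poly) auto
  have eval: "real (ehrhart ?Q t) = from_h_vector d ?h t" for t
    unfolding ehrhart_eq_card_reduced_weights[OF arcs] card_reduced_weights from_h_vector_sum
    using le by (simp add: from_h_vector_face)
  have "h_star ?Q = (THE h. degree h \<le> d \<and> (\<forall>t. real (ehrhart ?Q t) = from_h_vector d h t))"
    using \<open>?Q \<noteq> {}\<close> by (simp add: h_star_def dim from_h_vector_def Let_def)
  also have "\<dots> = ?h"
  proof (rule the_equality)
    show "degree ?h \<le> d \<and> (\<forall>t. real (ehrhart ?Q t) = from_h_vector d ?h t)"
      using deg eval by blast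
    fix h assume "degree h \<le> d \<and> (\<forall>t. real (ehrhart ?Q t) = from_h_vector d h t)"
    then show "h = ?h" using deg eval by (intro from_h_vector_inject[of _ d]) auto
  qed
  finally show ?thesis by (simp add: d_def)
qed

end

text \<open>
  A digraph without arcs has no arc into the root to serve as an apex, and its root polytope is
  empty; both polynomials are then 1.
\<close>

lemma greedoid_polynomial_eq_h_star:
  assumes "t \<noteq> 0"
  shows "poly (greedoid_polynomial G r) t =
    t ^ (card (arcs G) + 1 - card (verts G)) * poly (h_star (root_polytope (arcs G) a)) (inverse t)"
proof (cases "arcs G = {}")
  case True
  have "v = r" if "v \<in> verts G" for v
    using spans_from_arcs[OF root] that True by (auto simp: spans_from_def arc_rel_def)
  then have verts: "verts G = {r}" using root by blast
  have K: "dual_complex (arcs G) (branching_greedoid_bases G r) = {{}}"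
    unfolding dual_complex_eq using spans_from_arcs[OF root] True by auto
  have "poly (greedoid_polynomial G r) t = 1"
    using complex_dim_dual_complex
    unfolding greedoid_polynomial_def h_polynomial_def f_polynomial_def K
    by (simp add: verts True simplex_dim_def poly_pcompose poly_monom)
  moreover have "h_star (root_polytope (arcs G) a) = 1"
    using True by (simp add: h_star_def root_polytope_def)
  ultimately show ?thesis using verts True by simp
next
  case False
  then obtain c where c: "c \<in> arcs G" "head G c = r" using arc_into_vertex[OF False root] by blast
  define d where "d = card (arcs G) - card (verts G)"
  have exponent: "card (arcs G) + 1 - card (verts G) = Suc d"
    using card_verts_le[OF c] by (simp add: d_def)
  have expand: "t ^ Suc d * poly (h_star (root_polytope (arcs G) a)) (inverse t) =
      (\<Sum>T\<in>base_faces c. t ^ Suc d * (inverse t ^ card T * (1 - inverse t) ^ (d - card T)))"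
    unfolding h_star_root_polytope[OF c] d_def[symmetric] poly_sum sum_distrib_left
    by (intro sum.cong refl) (simp add: poly_monom)
  have summand: "t ^ Suc d * (inverse t ^ card T * (1 - inverse t) ^ (d - card T)) = t * (t - 1) ^ (d - card T)"
    if "T \<in> base_faces c" for T
  proof -
    have "card T \<le> d" using card_base_face_le[OF c that] by (simp add: d_def)
    then have "t ^ Suc d = t * t ^ card T * t ^ (d - card T)"
      by (simp flip: power_add)
    then have "t ^ Suc d * (inverse t ^ card T * (1 - inverse t) ^ (d - card T))
        = t * (t * inverse t) ^ card T * (t * (1 - inverse t)) ^ (d - card T)"
      by (simp only: power_mult_distrib ac_simps)
    then show ?thesis using assms by (simp add: algebra_simps)
  qed
  show ?thesis
    unfolding poly_greedoid_polynomial[OF c] d_def[symmetric] exponent expand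
    by (rule sum.cong[OF refl]) (simp only: summand)
qed

end

theorem theorem1p1:
  fixes G :: "('v, 'e) pre_digraph" and v0 :: 'v and a :: "'e \<Rightarrow> int ^ 'n"
  assumes "eulerian_digraph G"
    and "v0 \<in> verts G"
    and "totally_unimodular (arcs G) a"
    and "represents_oriented_dual a G"
  shows "\<forall>t :: real. t \<noteq> 0 \<longrightarrow>
    poly (greedoid_polynomial G v0) t
      = t ^ (card (arcs G) + 1 - card (verts G)) * poly (h_star (root_polytope (arcs G) a)) (inverse t)"
proof -
  interpret eulerian_digraph G by fact
  interpret oriented_dual G a v0 by unfold_locales (fact assms)+
  show ?thesis using greedoid_polynomial_eq_h_star by blast
qed

end
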